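(* Let $G=(V,E)$ be an undirected graph and $\mathcal{A}$ an abelian group. Then the Vietoris-Rips homology $H_*^{VR}(G;\mathcal{A})$ of $G$ is isomorphic to the Vietoris-Rips homology $H_*^{VR}(\sigma(G);\mathcal{A})$ of the semi-uniform space $\sigma(G)$.
   Context: The Vietoris-Rips homology $H_*^{VR}(G;\mathcal{A})$ of a graph $G=(V,E)$ is the simplicial homology with coefficients in $\mathcal{A}$ of its clique (flag) complex: the simplicial complex on vertex set $V$ whose simplices are the finite sets of pairwise adjacent vertices. A semi-uniform structure on a set $X$ is a filter $\mathcal{U}$ on $X\times X$ (nonempty, not containing $\emptyset$, closed under supersets and finite intersections) such that every $U\in\mathcal{U}$ contains the diagonal and $U^{-1}=\{(y,x):(x,y)\in U\}\in\mathcal{U}$ for all $U\in\mathcal{U}$. $\sigma(G)=(V,\mathcal{E}_G)$, where $\mathcal{E}_G$ is the filter on $V\times V$ generated by $E\cup\Delta_V$ (edges regarded as symmetric pairs). For $U\in\mathcal{U}$, $X^U$ is the simplicial set with $X^U_n=\{(x_0,\dots,x_n)\in X^{n+1}:(x_i,x_j)\in U\text{ for all }i<j\}$ (entries need not be distinct), face maps $\partial_i$ deleting the $i$-th entry and degeneracies repeating it; $H_*(X^U;\mathcal{A})$ is the homology of $C_*(X^U)\otimes\mathcal{A}$ with $C_n(X^U)$ free abelian on $X^U_n$ and differential $\sum_i(-1)^i\partial_i$. Ordering $\mathcal{U}$ by $U\le U'$ iff $U'\subseteq U$, the Vietoris-Rips homology of $(X,\mathcal{U})$ is $H^{VR}_*(X;\mathcal{A})=\varprojlim_{U\in\mathcal{U}}H_*(X^U;\mathcal{A})$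 along maps induced by the inclusions $X^{U'}\subset X^U$ for $U'\subseteq U$. *)

theory Defs
  imports "HOL-Algebra.Algebra"
begin

definition undirected_graph :: "'v set \<Rightarrow> 'v set set \<Rightarrow> bool" where
  "undirected_graph V E \<longleftrightarrow> (\<forall>e\<in>E. e \<subseteq> V \<and> card e = 2)"

definition clique_complex :: "'v set \<Rightarrow> 'v set set \<Rightarrow> 'v set set" where
  "clique_complex V E = {s. finite s \<and> s \<noteq> {} \<and> s \<subseteq> V \<and>
                            (\<forall>x\<in>s. \<forall>y\<in>s. x \<noteq> y \<longrightarrow> {x, y} \<in> E)}"

definition semi_uniform :: "'v set \<Rightarrow> 'v rel set \<Rightarrow> bool" where
  "semi_uniform S UU \<longleftrightarrow>
     UU \<noteq> {} \<and> {} \<notin> UU \<and> (\<forall>U\<in>UU. U \<subseteq> (S \<times> S)) \<and>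
     (\<forall>U\<in>UU. \<forall>W. U \<subseteq> W \<and> W \<subseteq> (S \<times> S) \<longrightarrow> W \<in> UU) \<and>
     (\<forall>U\<in>UU. \<forall>W\<in>UU. U \<inter> W \<in> UU) \<and>
     (\<forall>U\<in>UU. Id_on S \<subseteq> U \<and> converse U \<in> UU)"

definition edge_rel :: "'v set set \<Rightarrow> 'v rel" where
  "edge_rel E = {(x, y). {x, y} \<in> E}"

definition sigma_graph :: "'v set \<Rightarrow> 'v set set \<Rightarrow> 'v rel set" where
  "sigma_graph V E = {U. edge_rel E \<union> Id_on V \<subseteq> U \<and> U \<subseteq> V \<times> V}"

text \<open>Chains with coefficients in the abelian group A (written multiplicatively, as in
  HOL-Algebra) are finitely supported functions from the basis to carrier A, with pointwise
  group operation.  (Free abelian group on a basis S tensored with A = direct sum of copies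
  of A indexed by S.)\<close>
definition pw_group :: "('a, 'm) monoid_scheme \<Rightarrow> ('b \<Rightarrow> 'a) set \<Rightarrow> ('b \<Rightarrow> 'a) monoid" where
  "pw_group A S = \<lparr>carrier = S, monoid.mult = (\<lambda>f g x. f x \<otimes>\<^bsub>A\<^esub> g x), one = (\<lambda>x. \<one>\<^bsub>A\<^esub>)\<rparr>"

text \<open>Homology in degree n of a chain complex given by chain sets C and boundaries d,
  with d n : C n \<rightarrow> C (n-1) and d 0 = 0:  ker (d n) / im (d (n+1)).\<close>
definition homology_of ::
  "('a, 'm) monoid_scheme \<Rightarrow> (nat \<Rightarrow> ('b \<Rightarrow> 'a) set) \<Rightarrow> (nat \<Rightarrow> ('b \<Rightarrow> 'a) \<Rightarrow> ('b \<Rightarrow> 'a))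
     \<Rightarrow> nat \<Rightarrow> ('b \<Rightarrow> 'a) set monoid" where
  "homology_of A C d n =
     (pw_group A {c \<in> C n. d n c = (\<lambda>x. \<one>\<^bsub>A\<^esub>)}) Mod (d (Suc n) ` C (Suc n))"

text \<open>Oriented n-chains of a simplicial complex K (a set of finite nonempty vertex sets) with
  coefficients in A: an oriented n-simplex is an ordered list of n+1 distinct vertices spanning a
  simplex, with [sigma o pi] = sgn(pi) [sigma]; a chain is encoded as the alternating, finitely
  supported function giving the coefficient of each ordering (changing sign under transpositions).\<close>
definition or_chains :: "('a, 'm) monoid_scheme \<Rightarrow> 'v set set \<Rightarrow> nat \<Rightarrow> ('v list \<Rightarrow> 'a) set" where
  "or_chains A K n = {f. (\<forall>xs. f xs \<in> carrier A) \<and>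
       (\<forall>xs. f xs \<noteq> \<one>\<^bsub>A\<^esub> \<longrightarrow> length xs = Suc n \<and> distinct xs \<and> set xs \<in> K) \<and>
       finite {xs. f xs \<noteq> \<one>\<^bsub>A\<^esub>} \<and>
       (\<forall>xs i j. i < length xs \<longrightarrow> j < length xs \<longrightarrow> i \<noteq> j \<longrightarrow>
            f (xs[i := xs ! j, j := xs ! i]) = inv\<^bsub>A\<^esub> (f xs))}"

text \<open>Simplicial boundary, in the alternating encoding: the coefficient of the oriented
  (n-1)-simplex [w1..wn] in the boundary of sum f(sigma)[sigma] is the sum over v of
  f [v,w1,...,wn] (the 0-th face of [v,w1,..,wn] is [w1..wn] with sign +1).  d 0 = 0.\<close>
definition or_bd :: "('a, 'm) monoid_scheme \<Rightarrow> nat \<Rightarrow> ('v list \<Rightarrow> 'a) \<Rightarrow> ('v list \<Rightarrow> 'a)" where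
  "or_bd A n f ys = (if 1 \<le> n \<and> length ys = n
       then finprod A (\<lambda>v. f (v # ys)) {v. f (v # ys) \<noteq> \<one>\<^bsub>A\<^esub>} else \<one>\<^bsub>A\<^esub>)"

definition simplicial_homology ::
  "('a, 'm) monoid_scheme \<Rightarrow> 'v set set \<Rightarrow> nat \<Rightarrow> ('v list \<Rightarrow> 'a) set monoid" where
  "simplicial_homology A K n = homology_of A (or_chains A K) (or_bd A) n"

definition graph_VR_homology ::
  "('a, 'm) monoid_scheme \<Rightarrow> 'v set \<Rightarrow> 'v set set \<Rightarrow> nat \<Rightarrow> ('v list \<Rightarrow> 'a) set monoid" where
  "graph_VR_homology A V E n = simplicial_homology A (clique_complex V E) n"

definition XU_simplices :: "'v set \<Rightarrow> 'v rel \<Rightarrow> nat \<Rightarrow> 'v list set" where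
  "XU_simplices S U n = {xs. length xs = Suc n \<and> set xs \<subseteq> S \<and>
       (\<forall>i j. i < j \<longrightarrow> j < length xs \<longrightarrow> (xs ! i, xs ! j) \<in> U)}"

definition XU_chains :: "('a, 'm) monoid_scheme \<Rightarrow> 'v set \<Rightarrow> 'v rel \<Rightarrow> nat \<Rightarrow> ('v list \<Rightarrow> 'a) set" where
  "XU_chains A S U n = {f. (\<forall>xs. f xs \<in> carrier A) \<and>
       (\<forall>xs. xs \<notin> XU_simplices S U n \<longrightarrow> f xs = \<one>\<^bsub>A\<^esub>) \<and> finite {xs. f xs \<noteq> \<one>\<^bsub>A\<^esub>}}"

text \<open>Differential sum_i (-1)^i d_i, d_i deleting the i-th entry; on coefficient functions:
  coefficient of ys in the boundary = sum_i (-1)^i sum_v f(ys with v inserted at position i).\<close>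
definition ins_at :: "nat \<Rightarrow> 'v \<Rightarrow> 'v list \<Rightarrow> 'v list" where
  "ins_at i v ys = take i ys @ v # drop i ys"

definition ord_bd :: "('a, 'm) monoid_scheme \<Rightarrow> nat \<Rightarrow> ('v list \<Rightarrow> 'a) \<Rightarrow> ('v list \<Rightarrow> 'a)" where
  "ord_bd A n f ys = (if 1 \<le> n \<and> length ys = n
       then finprod A (\<lambda>i. let s = finprod A (\<lambda>v. f (ins_at i v ys)) {v. f (ins_at i v ys) \<noteq> \<one>\<^bsub>A\<^esub>}
                            in if even i then s else inv\<^bsub>A\<^esub> s) {0..n}
       else \<one>\<^bsub>A\<^esub>)"

definition XU_homology :: "('a, 'm) monoid_scheme \<Rightarrow> 'v set \<Rightarrow> 'v rel \<Rightarrow> nat \<Rightarrow> ('v list \<Rightarrow> 'a) set monoid" where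
  "XU_homology A S U n = homology_of A (XU_chains A S U) (ord_bd A) n"

text \<open>For U' \<subseteq> U, S^U' \<subseteq> S^U, so chains of S^U' are chains of S^U (same encoding); the induced
  map on homology sends a class c to the class of im(d_{n+1}) in S^U containing it.\<close>
definition XU_restr :: "('a, 'm) monoid_scheme \<Rightarrow> 'v set \<Rightarrow> 'v rel \<Rightarrow> nat
     \<Rightarrow> ('v list \<Rightarrow> 'a) set \<Rightarrow> ('v list \<Rightarrow> 'a) set" where
  "XU_restr A S U n c =
     set_mult (pw_group A UNIV) (ord_bd A (Suc n) ` XU_chains A S U (Suc n)) c"

text \<open>Inverse limit over (UU, reverse inclusion) of the groups H_n(S^U;A), realised as the group of
  compatible families in the product.\<close>
definition VR_homology :: "('a, 'm) monoid_scheme \<Rightarrow> 'v set \<Rightarrow> 'v rel set \<Rightarrow> nat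
     \<Rightarrow> ('v rel \<Rightarrow> ('v list \<Rightarrow> 'a) set) monoid" where
  "VR_homology A S UU n =
     \<lparr>carrier = {h \<in> (\<Pi>\<^sub>E U\<in>UU. carrier (XU_homology A S U n)).
                   \<forall>U\<in>UU. \<forall>U'\<in>UU. U' \<subseteq> U \<longrightarrow> XU_restr A S U n (h U') = h U},
      monoid.mult = (\<lambda>h k. \<lambda>U\<in>UU. h U \<otimes>\<^bsub>XU_homology A S U n\<^esub> k U),
      one = (\<lambda>U\<in>UU. \<one>\<^bsub>XU_homology A S U n\<^esub>)\<rparr>"

end

theory Submission
  imports Defs
begin

text \<open>The filter of \<open>\<sigma>(G)\<close> has the least element \<open>U\<^sub>0 = E \<union> \<Delta>\<close>, so the inverse limit is the homology of
  \<open>X\<^bsup>U\<^sub>0\<^esup>\<close>, that is, the homology of the clique complex computed with ordered, possibly degenerate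
  tuples. To compare it with oriented homology, antisymmetrise tuples; after the choice of a linear order
  of the vertices, restricting an alternating chain to the ascending tuples is a right inverse of this
  chain map, and the composition in the other order is the signed sorting \<open>p\<close> of tuples. Writing \<open>x \<cdot> c\<close>
  for the cone that prepends \<open>x\<close> to every tuple of \<open>c\<close>, the recursion
  \<open>h (x # xs) = x \<cdot> (x \<cdot> p xs - p (x # xs) - h xs)\<close> defines a chain homotopy from the identity to \<open>p\<close>. It
  uses only entries of the given tuple, hence stays inside every simplex. All these maps are given by integer
  matrices, so the identities are proved over the integers and then tensored with the coefficients.\<close>

section \<open>Cones on integral tuple chains and extension by linearity\<close>

definition frag_cons :: "'v \<Rightarrow> ('v list \<Rightarrow>\<^sub>0 int) \<Rightarrow> ('v list \<Rightarrow>\<^sub>0 int)" where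
  "frag_cons x = frag_extend (\<lambda>ys. frag_of (x # ys))"

lemma frag_cons_simps [simp]:
  "frag_cons x 0 = 0"
  "frag_cons x (frag_of ys) = frag_of (x # ys)"
  "frag_cons x (- a) = - frag_cons x a"
  "frag_cons x (a + b) = frag_cons x a + frag_cons x b"
  "frag_cons x (a - b) = frag_cons x a - frag_cons x b"
  by (simp_all add: frag_cons_def frag_extend_add frag_extend_diff frag_extend_minus)

lemma keys_frag_cons: "Poly_Mapping.keys (frag_cons x c) \<subseteq> (#) x ` Poly_Mapping.keys c"
  using keys_frag_extend[of "\<lambda>ys. frag_of (x # ys)" c] by (auto simp: frag_cons_def)

lemma keys_diffE:
  assumes "z \<in> Poly_Mapping.keys (a - b)"
  obtains "z \<in> Poly_Mapping.keys a" | "z \<in> Poly_Mapping.keys b"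
  using assms keys_diff[of a b] by blast

lemma frag_extend_keysE:
  assumes "z \<in> Poly_Mapping.keys (frag_extend f c)"
  obtains y where "y \<in> Poly_Mapping.keys c" "z \<in> Poly_Mapping.keys (f y)"
  using assms keys_frag_extend[of f c] by blast

text \<open>Additive maps on a free abelian group are determined by the basis. Testing only the
  basis elements in the support of \<open>c\<close> lets side conditions on the keys, such as being
  ascending, enter the argument.\<close>

lemma frag_linear_ext:
  assumes "\<And>y. y \<in> Poly_Mapping.keys c \<Longrightarrow> F (frag_of y) = G (frag_of y)"
    and "F 0 = (0::'b::ab_group_add)" "G 0 = 0"
    and "\<And>a b. F (a - b) = F a - F b" "\<And>a b. G (a - b) = G a - G b"
  shows "F c = G c"
proof -
  have "Poly_Mapping.keys c \<subseteq> Poly_Mapping.keys c" by simp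
  then show ?thesis
    by (induction c rule: frag_induction) (use assms in auto)
qed

lemmas frag_extend_linear = frag_extend_add frag_extend_diff frag_extend_minus

section \<open>Integral chain maps on tuples\<close>

text \<open>The augmented boundary: a tuple of length one has boundary \<open>frag_of []\<close>, which makes the cone formula
  \<open>tuple_bd_frag_cons\<close> hold in every degree.\<close>

primrec tuple_bd :: "'v list \<Rightarrow> ('v list \<Rightarrow>\<^sub>0 int)" where
  "tuple_bd [] = 0"
| "tuple_bd (x # xs) = frag_of xs - frag_cons x (tuple_bd xs)"

abbreviation tuple_bd_ext :: "('v list \<Rightarrow>\<^sub>0 int) \<Rightarrow> ('v list \<Rightarrow>\<^sub>0 int)" where
  "tuple_bd_ext \<equiv> frag_extend tuple_bd"

text \<open>The cone is a contracting homotopy of the augmented complex of tuples. The inductive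
  boundary computations below rest on this formula.\<close>

lemma tuple_bd_frag_cons: "tuple_bd_ext (frag_cons x c) = c - frag_cons x (tuple_bd_ext c)"
  by (rule frag_linear_ext) (auto simp: frag_extend_linear)

lemma tuple_bd_tuple_bd: "tuple_bd_ext (tuple_bd xs) = 0"
  by (induction xs) (auto simp: frag_extend_linear tuple_bd_frag_cons)

text \<open>With membership in an entourage \<open>U\<close> as the relation \<open>R\<close>, this
  says that faces of simplices of \<open>X^U\<close> are again such simplices.\<close>

lemma keys_tuple_bd:
  assumes "ys \<in> Poly_Mapping.keys (tuple_bd xs)"
  shows "Suc (length ys) = length xs \<and> set ys \<subseteq> set xs \<and> (sorted_wrt R xs \<longrightarrow> sorted_wrt R ys)"
  using assms
proof (induction xs arbitrary: ys)
  case (Cons x xs)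
  then consider "ys = xs" | zs where "zs \<in> Poly_Mapping.keys (tuple_bd xs)" "ys = x # zs"
    using keys_frag_cons by (fastforce elim!: keys_diffE)
  then show ?case
  proof cases
    case 2
    then show ?thesis using Cons.IH[OF 2(1)] by auto
  qed auto
qed simp

text \<open>Each cone in the recursion shifts the deleted position by one and contributes one sign.
  The explicit sum is the form in which \<open>tuple_bd\<close> is matched with
  \<open>ord_bd\<close>.\<close>

lemma tuple_bd_eq_sum:
  "tuple_bd xs = (\<Sum>i<length xs. frag_cmul ((-1) ^ i) (frag_of (take i xs @ drop (Suc i) xs)))"
proof (induction xs)
  case (Cons x xs)
  have "frag_cons x (frag_cmul k c) = frag_cmul k (frag_cons x c)" for k c
    by (simp add: frag_cons_def frag_extend_cmul)
  moreover have "frag_cons x (sum g I) = (\<Sum>i\<in>I. frag_cons x (g i))" if "finite I" for g :: "nat \<Rightarrow> _" and I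
    using that by (induction I rule: finite_induct) auto
  ultimately have "frag_cons x (tuple_bd xs) =
      (\<Sum>i<length xs. frag_cmul ((-1) ^ i) (frag_of (x # take i xs @ drop (Suc i) xs)))"
    by (simp add: Cons.IH)
  moreover have "- (\<Sum>i<length xs. frag_cmul ((-1) ^ i) (frag_of (x # take i xs @ drop (Suc i) xs))) =
      (\<Sum>i<length xs. frag_cmul ((-1) ^ Suc i) (frag_of (x # take i xs @ drop (Suc i) xs)))"
    unfolding sum_negf [symmetric] by (rule sum.cong) simp_all
  ultimately show ?case
    by (simp add: sum.lessThan_Suc_shift del: sum.lessThan_Suc)
qed simp

section \<open>Antisymmetrisation of tuples by repeated signed shuffles\<close>

primrec shuffle_in :: "'v \<Rightarrow> 'v list \<Rightarrow> ('v list \<Rightarrow>\<^sub>0 int)" where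
  "shuffle_in x [] = frag_of [x]"
| "shuffle_in x (y # ys) = frag_of (x # y # ys) - frag_cons y (shuffle_in x ys)"

text \<open>\<open>antisymmetrize xs\<close> is the signed sum of all rearrangements of \<open>xs\<close>; it vanishes when \<open>xs\<close> has a
  repeated entry.\<close>

primrec antisymmetrize :: "'v list \<Rightarrow> ('v list \<Rightarrow>\<^sub>0 int)" where
  "antisymmetrize [] = frag_of []"
| "antisymmetrize (x # xs) = frag_extend (shuffle_in x) (antisymmetrize xs)"

text \<open>In the alternating encoding this is the matrix of the oriented boundary: the coefficient
  of \<open>ys\<close> collects those of all \<open>v # ys\<close>. The empty tuple goes to 0, as it
  does under \<open>tuple_bd\<close>.\<close>

definition drop_head :: "'v list \<Rightarrow> ('v list \<Rightarrow>\<^sub>0 int)" where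
  "drop_head xs = (if xs = [] then 0 else frag_of (tl xs))"

lemma drop_head_simps [simp]: "drop_head [] = 0" "drop_head (x # xs) = frag_of xs"
  by (simp_all add: drop_head_def)

lemma drop_head_frag_cons [simp]: "frag_extend drop_head (frag_cons x c) = c"
  by (rule frag_linear_ext) (auto simp: frag_extend_linear)

lemma antisymmetrize_frag_cons:
  "frag_extend antisymmetrize (frag_cons x c) = frag_extend (shuffle_in x) (frag_extend antisymmetrize c)"
  by (rule frag_linear_ext) (auto simp: frag_extend_linear)

text \<open>In the leading term of a shuffle \<open>x\<close> stands in front, and dropping it
  leaves the original tuple. In all other terms the old head stays in front with sign -1; dropping
  it leaves the shuffles of \<open>x\<close> into the tail.\<close>

lemma drop_head_shuffle_in:
  fixes c :: "'v list \<Rightarrow>\<^sub>0 int"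
  shows "frag_extend drop_head (frag_extend (shuffle_in x) c) = c - frag_extend (shuffle_in x) (frag_extend drop_head c)"
proof (rule frag_linear_ext[where c = c])
  show "frag_extend drop_head (frag_extend (shuffle_in x) (frag_of y)) =
      frag_of y - frag_extend (shuffle_in x) (frag_extend drop_head (frag_of y))" for y :: "'v list"
    by (cases y) (auto simp: frag_extend_linear)
qed (auto simp: frag_extend_linear)

text \<open>Antisymmetrisation is thus a chain map from ordered to oriented chains. Both sides obey
  the recursion of \<open>tuple_bd\<close> with \<open>shuffle_in x\<close> in place of the
  cone.\<close>

lemma antisymmetrize_tuple_bd: "frag_extend drop_head (antisymmetrize xs) = frag_extend antisymmetrize (tuple_bd xs)"
  by (induction xs) (auto simp: frag_extend_linear drop_head_shuffle_in antisymmetrize_frag_cons)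

lemma keys_shuffle_in:
  assumes "zs \<in> Poly_Mapping.keys (shuffle_in x ys)"
  shows "\<exists>us vs. ys = us @ vs \<and> zs = us @ x # vs"
  using assms
proof (induction ys arbitrary: zs)
  case (Cons y ys)
  then consider "zs = x # y # ys" | ws where "ws \<in> Poly_Mapping.keys (shuffle_in x ys)" "zs = y # ws"
    using keys_frag_cons by (fastforce elim!: keys_diffE)
  then show ?case
  proof cases
    case 1
    then show ?thesis by (intro exI[of _ "[]"] exI[of _ "y # ys"]) auto
  next
    case 2
    with Cons.IH obtain us vs where "ys = us @ vs" "ws = us @ x # vs" by blast
    with 2 show ?thesis by (intro exI[of _ "y # us"] exI[of _ vs]) auto
  qed
qed auto

lemma keys_antisymmetrize: "zs \<in> Poly_Mapping.keys (antisymmetrize xs) \<Longrightarrow> mset zs = mset xs"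
proof (induction xs arbitrary: zs)
  case (Cons x xs)
  then obtain ys where "ys \<in> Poly_Mapping.keys (antisymmetrize xs)" "zs \<in> Poly_Mapping.keys (shuffle_in x ys)"
    by (auto elim: frag_extend_keysE)
  with Cons.IH keys_shuffle_in show ?case by fastforce
qed auto

subsection \<open>Alternation\<close>

text \<open>Adjacent transpositions suffice, since they generate all permutations, and they fit
  induction on lists. Arbitrary transpositions are recovered in
  \<open>alternating_swap\<close>.\<close>

definition alternating :: "('v list \<Rightarrow> int) \<Rightarrow> bool" where
  "alternating c \<longleftrightarrow> (\<forall>us x y vs. c (us @ y # x # vs) = - c (us @ x # y # vs))"

text \<open>Fixing the first entry to be \<open>z\<close> and forgetting it turns a statement about
  coefficients of \<open>z # zs\<close> into one about coefficients of \<open>zs\<close>.\<close>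

definition slice :: "'v \<Rightarrow> ('v list \<Rightarrow>\<^sub>0 int) \<Rightarrow> ('v list \<Rightarrow>\<^sub>0 int)" where
  "slice z = frag_extend (\<lambda>ys. if ys \<noteq> [] \<and> hd ys = z then frag_of (tl ys) else 0)"

lemma lookup_slice: "Poly_Mapping.lookup (slice z c) zs = Poly_Mapping.lookup c (z # zs)"
proof (rule frag_linear_ext[where F = "\<lambda>c. Poly_Mapping.lookup (slice z c) zs"])
  show "Poly_Mapping.lookup (slice z (frag_of y)) zs = Poly_Mapping.lookup (frag_of y) (z # zs)" for y
    by (cases y) (auto simp: slice_def)
qed (auto simp: slice_def frag_extend_linear lookup_minus)

lemma lookup_frag_cons:
  "Poly_Mapping.lookup (frag_cons y c) (z # zs) = (if y = z then Poly_Mapping.lookup c zs else 0)"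
  by (rule frag_linear_ext[where F = "\<lambda>c. Poly_Mapping.lookup (frag_cons y c) (z # zs)"])
     (auto simp: lookup_minus)

lemma lookup_shuffle_in:
  "Poly_Mapping.lookup (frag_extend (shuffle_in x) c) (z # zs) =
     (if z = x then Poly_Mapping.lookup c zs else 0) - Poly_Mapping.lookup (frag_extend (shuffle_in x) (slice z c)) zs"
proof (rule frag_linear_ext[where F = "\<lambda>c. Poly_Mapping.lookup (frag_extend (shuffle_in x) c) (z # zs)"])
  fix y
  show "Poly_Mapping.lookup (frag_extend (shuffle_in x) (frag_of y)) (z # zs) =
     (if z = x then Poly_Mapping.lookup (frag_of y) zs else 0) -
     Poly_Mapping.lookup (frag_extend (shuffle_in x) (slice z (frag_of y))) zs"
    by (cases y) (auto simp: slice_def lookup_minus lookup_frag_cons)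
qed (auto simp: slice_def frag_extend_linear lookup_minus)

lemma alternating_ConsD: "alternating c \<Longrightarrow> alternating (\<lambda>zs. c (z # zs))"
  unfolding alternating_def by (metis append_Cons)

text \<open>By induction on the prefix in front of the transposed pair: slicing strips one prefix
  entry from both sides and preserves alternation.\<close>

lemma alternating_shuffle_in:
  assumes "alternating (Poly_Mapping.lookup c)"
  shows "alternating (Poly_Mapping.lookup (frag_extend (shuffle_in x) c))"
proof -
  have "Poly_Mapping.lookup (frag_extend (shuffle_in x) c) (us @ b # a # vs) =
      - Poly_Mapping.lookup (frag_extend (shuffle_in x) c) (us @ a # b # vs)" for us a b vs
    using assms
  proof (induction us arbitrary: c)
    case Nil
    \<comment> \<open>With the prefix used up, unfolding the coefficient twice leaves two terms that
      trade places with opposite signs and one double slice, whose sign change is this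
      equation.\<close>
    have "slice a (slice b c) = - slice b (slice a c)"
      using Nil[unfolded alternating_def, rule_format, of "[]" a b]
      by (intro poly_mapping_eqI) (simp add: lookup_slice)
    then show ?case
      by (simp add: lookup_shuffle_in lookup_slice frag_extend_minus)
  next
    case (Cons u us)
    have "alternating (Poly_Mapping.lookup (slice u c))"
      using alternating_ConsD[OF Cons.prems, of u] unfolding alternating_def lookup_slice .
    moreover have "Poly_Mapping.lookup c (us @ b # a # vs) = - Poly_Mapping.lookup c (us @ a # b # vs)"
      using Cons.prems unfolding alternating_def by blast
    ultimately show ?case
      using Cons.IH[of "slice u c"] by (simp add: lookup_shuffle_in)
  qed
  then show ?thesis unfolding alternating_def by blast
qed

lemma alternating_antisymmetrize: "alternating (Poly_Mapping.lookup (antisymmetrize xs))"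
proof (induction xs)
  case Nil
  show ?case by (simp add: alternating_def)
qed (simp add: alternating_shuffle_in)

lemma alternating_move:
  assumes "alternating c"
  shows "c (us @ x # ms @ vs) = (-1) ^ length ms * c (us @ ms @ x # vs)"
proof (induction ms arbitrary: us)
  case (Cons m ms)
  have "c (us @ x # m # ms @ vs) = - c ((us @ [m]) @ x # ms @ vs)"
    using assms[unfolded alternating_def, rule_format, of us m x "ms @ vs"] by simp
  also have "\<dots> = - ((-1) ^ length ms * c ((us @ [m]) @ ms @ x # vs))"
    by (simp only: Cons.IH)
  finally show ?case by simp
qed simp

text \<open>The front entry is carried past \<open>ms\<close> to meet the other one, the adjacent
  pair is swapped, and the new front entry is carried back. The two signs
  \<open>(-1) ^ length ms\<close> cancel.\<close>

lemma alternating_swap_aux: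
  assumes "alternating c"
  shows "c (us @ y # ms @ x # vs) = - c (us @ x # ms @ y # vs)"
proof -
  have "c (us @ y # ms @ x # vs) = (-1) ^ length ms * c (us @ ms @ y # x # vs)"
    using alternating_move[OF assms, of us y ms "x # vs"] by simp
  also have "c (us @ ms @ y # x # vs) = - c (us @ ms @ x # y # vs)"
    using assms[unfolded alternating_def, rule_format, of "us @ ms" x y vs] by simp
  also have "(-1) ^ length ms * \<dots> = - c (us @ x # ms @ y # vs)"
    using alternating_move[OF assms, of us x ms "y # vs"] by simp
  finally show ?thesis .
qed

lemma alternating_swap:
  assumes "alternating c" "i < length xs" "j < length xs" "i \<noteq> j"
  shows "c (xs[i := xs ! j, j := xs ! i]) = - c xs"
proof -
  have *: "c (xs[i := xs ! j, j := xs ! i]) = - c xs" if "i < j" "j < length xs" for i j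
  proof -
    define us x ms y vs where "us = take i xs" and "x = xs ! i"
      and "ms = take (j - Suc i) (drop (Suc i) xs)" and "y = xs ! j" and "vs = drop (Suc j) xs"
    have ds: "drop (Suc i) xs = ms @ y # vs"
      using that unfolding ms_def y_def vs_def
      by (metis (no_types, lifting) Suc_leI append_take_drop_id Cons_nth_drop_Suc drop_drop le_add_diff_inverse2)
    have xs: "xs = us @ x # ms @ y # vs"
      using that ds unfolding us_def x_def by (metis id_take_nth_drop order.strict_trans)
    have lu: "length us = i" and lm: "length ms = j - Suc i"
      using that by (auto simp: us_def ms_def)
    have "j - i = Suc (length ms)"
      using lm that by simp
    then have "xs[i := y, j := x] = us @ y # ms @ x # vs"
      unfolding xs using lu that by (simp add: list_update_append)
    moreover have "c (us @ y # ms @ x # vs) = - c (us @ x # ms @ y # vs)"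
      by (rule alternating_swap_aux[OF assms(1)])
    ultimately show ?thesis
      by (metis x_def xs y_def)
  qed
  show ?thesis
  proof (cases "i < j")
    case True
    then show ?thesis using * assms by blast
  next
    case False
    with assms * [of j i] show ?thesis by (simp add: list_update_swap)
  qed
qed

text \<open>Swapping two equal entries changes nothing but the sign, so the coefficient equals its
  own negative. This forces 0 over the integers, but not in a coefficient group with 2-torsion;
  hence the argument is made before tensoring.\<close>

lemma alternating_not_distinct:
  assumes "alternating c" "\<not> distinct xs"
  shows "c xs = 0"
proof -
  obtain i j where "i < length xs" "j < length xs" "i \<noteq> j" "xs ! i = xs ! j"
    using assms(2) by (auto simp: distinct_conv_nth)
  with alternating_swap[OF assms(1), of i xs j] show ?thesis
    by (metis equal_neg_zero list_update_id)
qed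

subsection \<open>Signed sorting\<close>

locale strict_total_order =
  fixes lt :: "'v \<Rightarrow> 'v \<Rightarrow> bool"  (infix "\<lless>" 50)
  assumes irrefl: "\<not> x \<lless> x"
    and trans: "x \<lless> y \<Longrightarrow> y \<lless> z \<Longrightarrow> x \<lless> z"
    and total: "x \<noteq> y \<Longrightarrow> x \<lless> y \<or> y \<lless> x"
begin

lemma asym: "x \<lless> y \<Longrightarrow> \<not> y \<lless> x"
  using irrefl trans by blast

abbreviation ascending :: "'v list \<Rightarrow> bool" where
  "ascending \<equiv> sorted_wrt (\<lless>)"

definition keep_ascending :: "'v list \<Rightarrow> ('v list \<Rightarrow>\<^sub>0 int)" where
  "keep_ascending xs = (if ascending xs then frag_of xs else 0)"

lemma keep_ascending_simps:
  "ascending xs \<Longrightarrow> keep_ascending xs = frag_of xs"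
  "\<not> ascending xs \<Longrightarrow> keep_ascending xs = 0"
  by (simp_all add: keep_ascending_def)

primrec insert_signed :: "'v \<Rightarrow> 'v list \<Rightarrow> ('v list \<Rightarrow>\<^sub>0 int)" where
  "insert_signed x [] = frag_of [x]"
| "insert_signed x (y # ys) =
     (if x \<lless> y then frag_of (x # y # ys) else if x = y then 0 else - frag_cons y (insert_signed x ys))"

text \<open>\<open>sort_signed xs\<close> is \<open>0\<close> if \<open>xs\<close> has a repeated entry, and otherwise the ascending rearrangement
  of \<open>xs\<close> with the sign of the sorting permutation.\<close>

primrec sort_signed :: "'v list \<Rightarrow> ('v list \<Rightarrow>\<^sub>0 int)" where
  "sort_signed [] = frag_of []"
| "sort_signed (x # xs) = frag_extend (insert_signed x) (sort_signed xs)"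

lemma keys_insert_signed:
  assumes "zs \<in> Poly_Mapping.keys (insert_signed x ys)" "ascending ys"
  shows "ascending zs \<and> mset zs = mset (x # ys)"
  using assms
proof (induction ys arbitrary: zs)
  case (Cons y ys)
  then consider "x \<lless> y" "zs = x # y # ys"
    | ws where "\<not> x \<lless> y" "x \<noteq> y" "ws \<in> Poly_Mapping.keys (insert_signed x ys)" "zs = y # ws"
    using keys_frag_cons by (fastforce split: if_split_asm)
  then show ?case
  proof cases
    case 1
    then show ?thesis using Cons.prems trans by auto
  next
    case 2
    with Cons have *: "ascending ws" "mset ws = mset (x # ys)" by auto
    then have "set ws = set (x # ys)" by (metis mset_eq_setD)
    with * 2 Cons.prems total[of x y] show ?thesis by auto
  qed
qed auto

lemma keys_sort_signed:
  "zs \<in> Poly_Mapping.keys (sort_signed xs) \<Longrightarrow> ascending zs \<and> mset zs = mset xs"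
proof (induction xs arbitrary: zs)
  case (Cons x xs)
  then obtain ys where "ys \<in> Poly_Mapping.keys (sort_signed xs)" "zs \<in> Poly_Mapping.keys (insert_signed x ys)"
    by (auto elim: frag_extend_keysE)
  with Cons.IH keys_insert_signed show ?case by fastforce
qed auto

lemma insert_signed_less: "(\<And>z. z \<in> set zs \<Longrightarrow> x \<lless> z) \<Longrightarrow> insert_signed x zs = frag_of (x # zs)"
  by (cases zs) auto

lemma insert_signed_ext_less:
  "(\<And>zs z. zs \<in> Poly_Mapping.keys c \<Longrightarrow> z \<in> set zs \<Longrightarrow> x \<lless> z) \<Longrightarrow> frag_extend (insert_signed x) c = frag_cons x c"
  by (rule frag_linear_ext) (auto simp: frag_extend_linear insert_signed_less)

lemma insert_signed_frag_cons_same: "frag_extend (insert_signed y) (frag_cons y c) = 0"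
  by (rule frag_linear_ext) (auto simp: frag_extend_linear irrefl)

lemma insert_signed_frag_cons_greater:
  assumes "y \<lless> x"
  shows "frag_extend (insert_signed x) (frag_cons y c) = - frag_cons y (frag_extend (insert_signed x) c)"
proof -
  have "\<not> x \<lless> y" "x \<noteq> y" using assms asym irrefl by blast+
  then show ?thesis
    by - (rule frag_linear_ext[where c = c], auto simp: frag_extend_linear)
qed

text \<open>Signed insertion satisfies the same boundary formula as the cone, by comparing
  \<open>x\<close> with the head: a smaller \<open>x\<close> makes insertion a cone, a larger one
  lets the head be split off.\<close>

lemma tuple_bd_insert_signed:
  "ascending ys \<Longrightarrow> tuple_bd_ext (insert_signed x ys) = frag_of ys - frag_extend (insert_signed x) (tuple_bd ys)"
proof (induction ys)
  case (Cons y ys)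
  consider "x \<lless> y" | "x = y" | "y \<lless> x" using total by blast
  then show ?case
  proof cases
    case 1
    have "x \<lless> z" if "zs \<in> Poly_Mapping.keys (tuple_bd (y # ys))" "z \<in> set zs" for zs z
    proof -
      have "z = y \<or> z \<in> set ys"
        using keys_tuple_bd[OF that(1)] that(2) by auto
      with 1 Cons.prems trans[of x y z] show ?thesis by auto
    qed
    then have "frag_extend (insert_signed x) (tuple_bd (y # ys)) = frag_cons x (tuple_bd (y # ys))"
      by (rule insert_signed_ext_less)
    with 1 show ?thesis by simp
  next
    case 2
    \<comment> \<open>The left-hand side is 0 here. On the right, inserting \<open>y\<close> into
      the first face gives back the whole tuple, and inserting it into the faces that still begin
      with \<open>y\<close> gives 0.\<close>
    have "insert_signed y ys = frag_of (y # ys)"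
      using Cons.prems by (intro insert_signed_less) auto
    with 2 show ?thesis
      by (simp add: irrefl frag_extend_linear insert_signed_frag_cons_same)
  next
    case 3
    moreover from 3 have "\<not> x \<lless> y" "x \<noteq> y" using asym irrefl by blast+
    ultimately show ?thesis
      using Cons by (simp add: frag_extend_linear insert_signed_frag_cons_greater tuple_bd_frag_cons)
  qed
qed simp

lemma tuple_bd_insert_signed_ext:
  assumes "\<And>ys. ys \<in> Poly_Mapping.keys c \<Longrightarrow> ascending ys"
  shows "tuple_bd_ext (frag_extend (insert_signed x) c) = c - frag_extend (insert_signed x) (tuple_bd_ext c)"
  by (rule frag_linear_ext) (auto simp: frag_extend_linear tuple_bd_insert_signed assms)

lemma sort_signed_frag_cons:
  "frag_extend sort_signed (frag_cons x c) = frag_extend (insert_signed x) (frag_extend sort_signed c)"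
  by (rule frag_linear_ext) (auto simp: frag_extend_linear)

lemma tuple_bd_sort_signed: "tuple_bd_ext (sort_signed xs) = frag_extend sort_signed (tuple_bd xs)"
proof (induction xs)
  case (Cons x xs)
  then show ?case
    using keys_sort_signed
    by (auto simp: tuple_bd_insert_signed_ext frag_extend_linear sort_signed_frag_cons)
qed simp

lemma sort_signed_ascending: "ascending xs \<Longrightarrow> sort_signed xs = frag_of xs"
  by (induction xs) (auto intro: insert_signed_less)

lemma keep_ascending_frag_cons:
  assumes "\<And>zs z. zs \<in> Poly_Mapping.keys c \<Longrightarrow> z \<in> set zs \<Longrightarrow> y \<lless> z"
  shows "frag_extend keep_ascending (frag_cons y c) = frag_cons y (frag_extend keep_ascending c)"
  by (rule frag_linear_ext) (auto simp: frag_extend_linear keep_ascending_def assms)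

lemma keep_ascending_frag_cons_zero:
  assumes "\<And>zs. zs \<in> Poly_Mapping.keys c \<Longrightarrow> \<exists>z\<in>set zs. \<not> y \<lless> z"
  shows "frag_extend keep_ascending (frag_cons y c) = 0"
  by (rule frag_linear_ext) (use assms in \<open>auto simp: frag_extend_linear keep_ascending_def\<close>)

text \<open>At most one position for \<open>x\<close> keeps the tuple ascending, and none does if
  \<open>x\<close> already occurs. The sign of the surviving shuffle counts the entries that
  \<open>x\<close> has passed, as in \<open>insert_signed\<close>.\<close>

lemma keep_ascending_shuffle_in_ascending:
  "ascending ys \<Longrightarrow> frag_extend keep_ascending (shuffle_in x ys) = insert_signed x ys"
proof (induction ys)
  case Nil
  then show ?case by (simp add: keep_ascending_simps)
next
  case (Cons y ys)
  have set_keys: "set zs = insert x (set ys)" if "zs \<in> Poly_Mapping.keys (shuffle_in x ys)" for zs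
    using keys_shuffle_in[OF that] by auto
  consider "x \<lless> y" | "x = y" | "y \<lless> x" using total by blast
  then show ?case
  proof cases
    case 1
    then have "frag_extend keep_ascending (frag_cons y (shuffle_in x ys)) = 0"
      using set_keys asym by (intro keep_ascending_frag_cons_zero) blast
    moreover have "ascending (x # y # ys)"
      using 1 Cons.prems trans by auto
    ultimately show ?thesis
      using 1 by (simp add: frag_extend_linear keep_ascending_simps)
  next
    case 2
    then have "frag_extend keep_ascending (frag_cons y (shuffle_in x ys)) = 0"
      using set_keys irrefl by (intro keep_ascending_frag_cons_zero) blast
    with 2 show ?thesis by (simp add: frag_extend_linear keep_ascending_simps irrefl)
  next
    case 3
    then have "frag_extend keep_ascending (frag_cons y (shuffle_in x ys)) =
        frag_cons y (frag_extend keep_ascending (shuffle_in x ys))"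
      using set_keys Cons.prems by (intro keep_ascending_frag_cons) auto
    moreover from 3 have "\<not> x \<lless> y" "x \<noteq> y" using asym irrefl by blast+
    ultimately show ?thesis
      using Cons by (simp add: frag_extend_linear keep_ascending_simps)
  qed
qed

lemma keep_ascending_shuffle_in:
  "frag_extend keep_ascending (frag_extend (shuffle_in x) c) =
     frag_extend (insert_signed x) (frag_extend keep_ascending c)"
proof (rule frag_linear_ext[where c = c])
  fix ys
  show "frag_extend keep_ascending (frag_extend (shuffle_in x) (frag_of ys)) =
     frag_extend (insert_signed x) (frag_extend keep_ascending (frag_of ys))"
  proof (cases "ascending ys")
    case True
    then show ?thesis by (simp add: keep_ascending_shuffle_in_ascending) (simp add: keep_ascending_simps)
  next
    case False
    \<comment> \<open>Every shuffle contains \<open>ys\<close> as a subsequence, so a descent or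
      repetition in \<open>ys\<close> persists.\<close>
    then have "\<not> ascending zs" if "zs \<in> Poly_Mapping.keys (shuffle_in x ys)" for zs
      using keys_shuffle_in[OF that] by (auto simp: sorted_wrt_append)
    then have "frag_extend keep_ascending (shuffle_in x ys) = 0"
      by (intro frag_extend_eq_0) (simp add: keep_ascending_simps)
    with False show ?thesis by (simp add: keep_ascending_simps)
  qed
qed (auto simp: frag_extend_linear)

lemma keep_ascending_antisymmetrize: "frag_extend keep_ascending (antisymmetrize xs) = sort_signed xs"
  by (induction xs) (simp_all add: keep_ascending_shuffle_in, simp add: keep_ascending_simps)

section \<open>The chain homotopy from the identity to signed sorting\<close>

primrec sort_homotopy :: "'v list \<Rightarrow> ('v list \<Rightarrow>\<^sub>0 int)" where
  "sort_homotopy [] = 0"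
| "sort_homotopy (x # xs) =
     frag_cons x (frag_cons x (sort_signed xs) - sort_signed (x # xs) - sort_homotopy xs)"

lemma sort_homotopy_frag_cons:
  "frag_extend sort_homotopy (frag_cons x c) =
     frag_cons x (frag_cons x (frag_extend sort_signed c) - frag_extend sort_signed (frag_cons x c)
       - frag_extend sort_homotopy c)"
  by (rule frag_linear_ext) (auto simp: frag_extend_linear)

text \<open>Let \<open>w\<close> be the argument of the outer cone, so that the boundary of
  \<open>sort_homotopy (x # xs)\<close> is \<open>w\<close> minus the cone over the boundary of
  \<open>w\<close>. By the induction hypothesis, that boundary is
  \<open>sort_signed xs - frag_of xs\<close> minus the expression whose cone is
  \<open>sort_homotopy\<close> of the cone over \<open>tuple_bd xs\<close>. The latter cancels
  against \<open>h_bd\<close>, and \<open>frag_of (x # xs) - sort_signed (x # xs)\<close>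
  remains.\<close>

lemma sort_homotopy:
  "tuple_bd_ext (sort_homotopy xs) + frag_extend sort_homotopy (tuple_bd xs) = frag_of xs - sort_signed xs"
proof (induction xs)
  case (Cons x xs)
  then have IH: "tuple_bd_ext (sort_homotopy xs) =
      frag_of xs - sort_signed xs - frag_extend sort_homotopy (tuple_bd xs)"
    by (simp add: algebra_simps)
  define w where "w = frag_cons x (sort_signed xs) - sort_signed (x # xs) - sort_homotopy xs"
  have "tuple_bd_ext w = sort_signed xs - frag_cons x (frag_extend sort_signed (tuple_bd xs))
      - frag_extend sort_signed (tuple_bd (x # xs)) - tuple_bd_ext (sort_homotopy xs)"
    unfolding w_def frag_extend_diff tuple_bd_frag_cons tuple_bd_sort_signed ..
  then have bd_w: "tuple_bd_ext w = sort_signed xs - frag_cons x (frag_extend sort_signed (tuple_bd xs))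
      - (sort_signed xs - frag_extend sort_signed (frag_cons x (tuple_bd xs)))
      - (frag_of xs - sort_signed xs - frag_extend sort_homotopy (tuple_bd xs))"
    by (simp add: IH frag_extend_linear)
  have bd_h: "tuple_bd_ext (sort_homotopy (x # xs)) = w - frag_cons x (tuple_bd_ext w)"
    by (simp only: sort_homotopy.simps tuple_bd_frag_cons flip: w_def)
  have h_bd: "frag_extend sort_homotopy (tuple_bd (x # xs)) =
      sort_homotopy xs - frag_extend sort_homotopy (frag_cons x (tuple_bd xs))"
    by (simp add: frag_extend_linear)
  show ?case
    unfolding bd_h h_bd bd_w sort_homotopy_frag_cons by (simp add: w_def algebra_simps)
qed simp

lemma keys_sort_homotopy:
  "zs \<in> Poly_Mapping.keys (sort_homotopy xs) \<Longrightarrow> length zs = Suc (length xs) \<and> set zs \<subseteq> set xs"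
proof (induction xs arbitrary: zs)
  case (Cons x xs)
  then obtain ys where ys: "zs = x # ys"
      "ys \<in> Poly_Mapping.keys (frag_cons x (sort_signed xs) - sort_signed (x # xs) - sort_homotopy xs)"
    using subsetD[OF keys_frag_cons Cons.prems[unfolded sort_homotopy.simps]] by blast
  consider "ys \<in> Poly_Mapping.keys (frag_cons x (sort_signed xs))" | "ys \<in> Poly_Mapping.keys (sort_signed (x # xs))"
    | "ys \<in> Poly_Mapping.keys (sort_homotopy xs)"
    using ys(2) by (elim keys_diffE)
  then have "length ys = Suc (length xs) \<and> set ys \<subseteq> set (x # xs)"
  proof cases
    case 1
    then obtain us where us: "ys = x # us" "us \<in> Poly_Mapping.keys (sort_signed xs)"
      using subsetD[OF keys_frag_cons 1] by blast
    then have "mset us = mset xs" using keys_sort_signed by blast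
    then have "length us = length xs" "set us = set xs"
      by (rule mset_eq_length, rule mset_eq_setD)
    with us(1) show ?thesis by auto
  next
    case 2
    then have "mset ys = mset (x # xs)" using keys_sort_signed by blast
    then have "length ys = length (x # xs)" "set ys = set (x # xs)"
      by (rule mset_eq_length, rule mset_eq_setD)
    then show ?thesis by simp
  next
    case 3
    then show ?thesis using Cons.IH by auto
  qed
  with ys(1) show ?case by auto
qed simp

end

text \<open>A well-order of the whole vertex type supplies the order.\<close>

lemma ex_strict_total_order: "\<exists>lt :: 'v \<Rightarrow> 'v \<Rightarrow> bool. strict_total_order lt"
proof -
  obtain r :: "'v rel" where r: "Well_order r" "Field r = UNIV"
    using well_ordering by metis
  then have "Linear_order r" by (simp add: well_order_on_def)
  then have "strict_total_order (\<lambda>x y. x \<noteq> y \<and> (x, y) \<in> r)"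
    using r(2)
    by unfold_locales
       (auto simp: order_on_defs antisym_def total_on_def dest: transD)
  then show ?thesis by blast
qed

section \<open>Chains with coefficients\<close>

definition fin_chains :: "('a, 'm) monoid_scheme \<Rightarrow> ('b \<Rightarrow> 'a) set" where
  "fin_chains G = {f. (\<forall>x. f x \<in> carrier G) \<and> finite {x. f x \<noteq> \<one>\<^bsub>G\<^esub>}}"

text \<open>The map \<open>\<phi> \<otimes> G\<close> on coefficient functions, for a homomorphism \<open>\<phi>\<close> of free abelian groups given on
  basis elements.\<close>

definition tensor_map ::
  "('a, 'm) monoid_scheme \<Rightarrow> ('b \<Rightarrow> ('c \<Rightarrow>\<^sub>0 int)) \<Rightarrow> ('b \<Rightarrow> 'a) \<Rightarrow> ('c \<Rightarrow> 'a)" where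
  "tensor_map G \<phi> f y = finprod G (\<lambda>x. f x [^]\<^bsub>G\<^esub> Poly_Mapping.lookup (\<phi> x) y) {x. f x \<noteq> \<one>\<^bsub>G\<^esub>}"

lemma lookup_frag_extend:
  assumes "finite S" "Poly_Mapping.keys c \<subseteq> S"
  shows "Poly_Mapping.lookup (frag_extend \<psi> c) y =
      (\<Sum>z\<in>S. Poly_Mapping.lookup c z * Poly_Mapping.lookup (\<psi> z) y)"
proof -
  have "Poly_Mapping.lookup (frag_extend \<psi> c) y =
      (\<Sum>z\<in>Poly_Mapping.keys c. Poly_Mapping.lookup c z * Poly_Mapping.lookup (\<psi> z) y)"
    by (simp add: frag_extend_def lookup_sum)
  also have "\<dots> = (\<Sum>z\<in>S. Poly_Mapping.lookup c z * Poly_Mapping.lookup (\<psi> z) y)"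
    using assms by (intro sum.mono_neutral_left) (auto simp: in_keys_iff)
  finally show ?thesis .
qed

context comm_group
begin

lemma fin_chainsD:
  assumes "f \<in> fin_chains G"
  shows "f x \<in> carrier G" "finite {x. f x \<noteq> \<one>}"
  using assms by (auto simp: fin_chains_def)

lemma finprod_swap:
  assumes "finite A" "finite B" "\<And>a b. f a b \<in> carrier G"
  shows "(\<Otimes>a\<in>A. \<Otimes>b\<in>B. f a b) = (\<Otimes>b\<in>B. \<Otimes>a\<in>A. f a b)"
  using assms(1)
proof (induction A rule: finite_induct)
  case (insert a F)
  then show ?case
    using assms(2,3) by (simp add: finprod_multf Pi_def)
qed simp

lemma finprod_int_pow:
  assumes "finite A" "\<And>a. f a \<in> carrier G"
  shows "(\<Otimes>a\<in>A. f a) [^] (k::int) = (\<Otimes>a\<in>A. f a [^] k)"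
  using assms(1)
  by (induction A rule: finite_induct) (use assms(2) in \<open>auto simp: int_pow_distrib\<close>)

lemma int_pow_sum:
  assumes "finite A" "a \<in> carrier G"
  shows "a [^] (\<Sum>z\<in>A. k z :: int) = (\<Otimes>z\<in>A. a [^] k z)"
  using assms(1)
  by (induction A rule: finite_induct) (use assms(2) in \<open>auto simp: int_pow_mult\<close>)

text \<open>Enlarging the index set by trivial factors lets several chains be treated over one
  common finite set.\<close>

lemma tensor_map_superset:
  assumes "f \<in> fin_chains G" "finite S" "{x. f x \<noteq> \<one>} \<subseteq> S"
  shows "tensor_map G \<phi> f y = (\<Otimes>x\<in>S. f x [^] Poly_Mapping.lookup (\<phi> x) y)"
  unfolding tensor_map_def
  by (rule finprod_mono_neutral_cong_left) (use assms in \<open>auto simp: fin_chains_def\<close>)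

text \<open>All claims about supports of transformed chains, on lengths as well as on simplices, are
  reduced by this to claims about the keys of the integral map.\<close>

lemma tensor_map_support:
  assumes "f \<in> fin_chains G" "tensor_map G \<phi> f y \<noteq> \<one>"
  shows "\<exists>x. f x \<noteq> \<one> \<and> y \<in> Poly_Mapping.keys (\<phi> x)"
proof (rule ccontr)
  assume "\<not> ?thesis"
  then have "f x [^] Poly_Mapping.lookup (\<phi> x) y = \<one>" if "f x \<noteq> \<one>" for x
    using that by (metis in_keys_iff int_pow_0)
  then have "tensor_map G \<phi> f y = \<one>"
    unfolding tensor_map_def by (intro finprod_one_eqI) simp
  with assms(2) show False by simp
qed

lemma tensor_map_closed:
  assumes "f \<in> fin_chains G"
  shows "tensor_map G \<phi> f \<in> fin_chains G"
proof -
  have "{y. tensor_map G \<phi> f y \<noteq> \<one>} \<subseteq> (\<Union>x\<in>{x. f x \<noteq> \<one>}. Poly_Mapping.keys (\<phi> x))"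
    using tensor_map_support[OF assms, of \<phi>] by auto
  moreover have "finite (\<Union>x\<in>{x. f x \<noteq> \<one>}. Poly_Mapping.keys (\<phi> x))"
    using fin_chainsD(2)[OF assms] by auto
  ultimately have "finite {y. tensor_map G \<phi> f y \<noteq> \<one>}"
    by (rule finite_subset)
  moreover have "tensor_map G \<phi> f y \<in> carrier G" for y
    unfolding tensor_map_def using fin_chainsD(1)[OF assms] by (intro finprod_closed) auto
  ultimately show ?thesis by (simp add: fin_chains_def)
qed

lemma tensor_map_cong:
  assumes "f \<in> fin_chains G" "\<And>x. f x \<noteq> \<one> \<Longrightarrow> \<phi> x = \<psi> x"
  shows "tensor_map G \<phi> f = tensor_map G \<psi> f"
  unfolding tensor_map_def
  by (intro ext finprod_cong') (use assms in \<open>auto simp: fin_chains_def\<close>)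

lemma tensor_map_mult:
  assumes "f \<in> fin_chains G" "g \<in> fin_chains G"
  shows "tensor_map G \<phi> (\<lambda>x. f x \<otimes> g x) = (\<lambda>y. tensor_map G \<phi> f y \<otimes> tensor_map G \<phi> g y)"
proof
  fix y
  let ?S = "{x. f x \<noteq> \<one>} \<union> {x. g x \<noteq> \<one>}"
  have S: "finite ?S" "{x. f x \<otimes> g x \<noteq> \<one>} \<subseteq> ?S"
    using assms by (auto simp: fin_chains_def)
  then have "(\<lambda>x. f x \<otimes> g x) \<in> fin_chains G"
    using assms by (auto simp: fin_chains_def intro: finite_subset)
  then have "tensor_map G \<phi> (\<lambda>x. f x \<otimes> g x) y = (\<Otimes>x\<in>?S. (f x \<otimes> g x) [^] Poly_Mapping.lookup (\<phi> x) y)"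
    using S by (rule tensor_map_superset)
  also have "\<dots> = (\<Otimes>x\<in>?S. f x [^] Poly_Mapping.lookup (\<phi> x) y \<otimes> g x [^] Poly_Mapping.lookup (\<phi> x) y)"
    using assms by (intro finprod_cong') (auto simp: fin_chains_def int_pow_distrib)
  also have "\<dots> = (\<Otimes>x\<in>?S. f x [^] Poly_Mapping.lookup (\<phi> x) y) \<otimes> (\<Otimes>x\<in>?S. g x [^] Poly_Mapping.lookup (\<phi> x) y)"
    using assms by (intro finprod_multf) (auto simp: fin_chains_def)
  also have "\<dots> = tensor_map G \<phi> f y \<otimes> tensor_map G \<phi> g y"
    using S(1) tensor_map_superset[OF assms(1), of ?S \<phi> y] tensor_map_superset[OF assms(2), of ?S \<phi> y] by simp
  finally show "tensor_map G \<phi> (\<lambda>x. f x \<otimes> g x) y = tensor_map G \<phi> f y \<otimes> tensor_map G \<phi> g y" .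
qed

lemma tensor_map_one [simp]: "tensor_map G \<phi> (\<lambda>x. \<one>) = (\<lambda>y. \<one>)"
  by (rule ext) (simp add: tensor_map_def)

lemma tensor_map_zero: "tensor_map G (\<lambda>x. 0) f = (\<lambda>y. \<one>)"
  by (rule ext) (simp add: tensor_map_def)

lemma tensor_map_add:
  assumes "f \<in> fin_chains G"
  shows "tensor_map G (\<lambda>x. \<phi> x + \<psi> x) f = (\<lambda>y. tensor_map G \<phi> f y \<otimes> tensor_map G \<psi> f y)"
proof
  fix y
  have "tensor_map G (\<lambda>x. \<phi> x + \<psi> x) f y =
      (\<Otimes>x\<in>{x. f x \<noteq> \<one>}. f x [^] Poly_Mapping.lookup (\<phi> x) y \<otimes> f x [^] Poly_Mapping.lookup (\<psi> x) y)"
    unfolding tensor_map_def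
    using assms by (intro finprod_cong') (auto simp: fin_chains_def lookup_add int_pow_mult)
  then show "tensor_map G (\<lambda>x. \<phi> x + \<psi> x) f y = tensor_map G \<phi> f y \<otimes> tensor_map G \<psi> f y"
    unfolding tensor_map_def using assms by (simp add: finprod_multf fin_chains_def Pi_def)
qed

lemma tensor_map_cmul:
  assumes "f \<in> fin_chains G"
  shows "tensor_map G (\<lambda>x. frag_cmul k (\<phi> x)) f y = tensor_map G \<phi> f y [^] k"
proof -
  have "tensor_map G \<phi> f y [^] k = (\<Otimes>x\<in>{x. f x \<noteq> \<one>}. (f x [^] Poly_Mapping.lookup (\<phi> x) y) [^] k)"
    unfolding tensor_map_def using assms by (intro finprod_int_pow) (auto simp: fin_chains_def)
  also have "\<dots> = tensor_map G (\<lambda>x. frag_cmul k (\<phi> x)) f y"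
    unfolding tensor_map_def
    using assms by (intro finprod_cong') (auto simp: fin_chains_def int_pow_pow mult.commute)
  finally show ?thesis ..
qed

lemma tensor_map_sum:
  assumes "f \<in> fin_chains G" "finite I"
  shows "tensor_map G (\<lambda>x. \<Sum>i\<in>I. \<phi> i x) f y = (\<Otimes>i\<in>I. tensor_map G (\<phi> i) f y)"
  using assms(2)
proof (induction I rule: finite_induct)
  case empty
  show ?case by (simp add: tensor_map_zero)
next
  case (insert i I)
  have "tensor_map G (\<phi> j) f y \<in> carrier G" for j
    by (rule fin_chainsD(1)[OF tensor_map_closed[OF assms(1)]])
  with insert show ?case
    by (simp add: tensor_map_add[OF assms(1)] Pi_def)
qed

text \<open>The map \<open>j\<close> parametrises the fibre of \<open>g\<close> over
  \<open>y\<close> within the support. For face maps the parameter is the inserted vertex, which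
  gives the products used in \<open>or_bd\<close> and \<open>ord_bd\<close>.\<close>

lemma tensor_map_frag_of_fibre:
  assumes "f \<in> fin_chains G" "inj j" "{x. f x \<noteq> \<one> \<and> g x = y} = j ` {v. f (j v) \<noteq> \<one>}"
  shows "tensor_map G (\<lambda>x. frag_of (g x)) f y = (\<Otimes>v\<in>{v. f (j v) \<noteq> \<one>}. f (j v))"
proof -
  have "tensor_map G (\<lambda>x. frag_of (g x)) f y = finprod G f {x. f x \<noteq> \<one> \<and> g x = y}"
    unfolding tensor_map_def
    by (rule finprod_mono_neutral_cong_right) (use assms(1) in \<open>auto simp: fin_chains_def\<close>)
  also have "\<dots> = (\<Otimes>v\<in>{v. f (j v) \<noteq> \<one>}. f (j v))"
    unfolding assms(3) using assms(1,2)
    by (intro finprod_reindex) (auto simp: fin_chains_def inj_on_def)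
  finally show ?thesis .
qed

lemma tensor_map_frag_of:
  assumes "f \<in> fin_chains G"
  shows "tensor_map G frag_of f = f"
proof
  fix y
  have "tensor_map G frag_of f y = finprod G f {x. f x \<noteq> \<one> \<and> x = y}"
    unfolding tensor_map_def
    by (rule finprod_mono_neutral_cong_right) (use assms(1) in \<open>auto simp: fin_chains_def\<close>)
  also have "\<dots> = f y"
  proof (cases "f y = \<one>")
    case True
    then have "{x. f x \<noteq> \<one> \<and> x = y} = {}" by auto
    with True show ?thesis by (simp only: finprod_empty)
  next
    case False
    then have "{x. f x \<noteq> \<one> \<and> x = y} = {y}" by auto
    then show ?thesis using fin_chainsD(1)[OF assms] by (simp only:) simp
  qed
  finally show "tensor_map G frag_of f y = f y" .
qed

text \<open>This is multiplication of matrices, by interchanging two finite products. It carries the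
  integral identities over to arbitrary coefficients.\<close>

lemma tensor_map_comp:
  assumes "f \<in> fin_chains G"
  shows "tensor_map G \<psi> (tensor_map G \<phi> f) = tensor_map G (\<lambda>x. frag_extend \<psi> (\<phi> x)) f"
proof
  fix y
  let ?F = "{x. f x \<noteq> \<one>}"
  let ?S = "\<Union>x\<in>?F. Poly_Mapping.keys (\<phi> x)"
  have car: "f x \<in> carrier G" for x
    using assms by (simp add: fin_chains_def)
  have fin: "finite ?F" "finite ?S"
    using fin_chainsD(2)[OF assms] by auto
  have "tensor_map G \<psi> (tensor_map G \<phi> f) y = (\<Otimes>z\<in>?S. tensor_map G \<phi> f z [^] Poly_Mapping.lookup (\<psi> z) y)"
    using tensor_map_support[OF assms, of \<phi>]
    by (intro tensor_map_superset tensor_map_closed assms fin) auto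
  also have "\<dots> = (\<Otimes>z\<in>?S. \<Otimes>x\<in>?F. f x [^] (Poly_Mapping.lookup (\<phi> x) z * Poly_Mapping.lookup (\<psi> z) y))"
    unfolding tensor_map_def
    by (intro finprod_cong') (auto simp: car fin finprod_int_pow int_pow_pow)
  also have "\<dots> = (\<Otimes>x\<in>?F. \<Otimes>z\<in>?S. f x [^] (Poly_Mapping.lookup (\<phi> x) z * Poly_Mapping.lookup (\<psi> z) y))"
    by (intro finprod_swap fin) (simp add: car)
  also have "\<dots> = (\<Otimes>x\<in>?F. f x [^] Poly_Mapping.lookup (frag_extend \<psi> (\<phi> x)) y)"
  proof (intro finprod_cong')
    fix x assume "x \<in> ?F"
    then have "Poly_Mapping.lookup (frag_extend \<psi> (\<phi> x)) y =
        (\<Sum>z\<in>?S. Poly_Mapping.lookup (\<phi> x) z * Poly_Mapping.lookup (\<psi> z) y)"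
      by (intro lookup_frag_extend fin) auto
    then show "(\<Otimes>z\<in>?S. f x [^] (Poly_Mapping.lookup (\<phi> x) z * Poly_Mapping.lookup (\<psi> z) y)) =
        f x [^] Poly_Mapping.lookup (frag_extend \<psi> (\<phi> x)) y"
      using int_pow_sum[OF fin(2) car] by simp
  qed (auto simp: car)
  finally show "tensor_map G \<psi> (tensor_map G \<phi> f) y = tensor_map G (\<lambda>x. frag_extend \<psi> (\<phi> x)) f y"
    by (simp add: tensor_map_def)
qed

lemma pw_group_comm_group:
  assumes "S \<subseteq> {f. \<forall>x. f x \<in> carrier G}" "(\<lambda>x. \<one>) \<in> S"
    and "\<And>f g. f \<in> S \<Longrightarrow> g \<in> S \<Longrightarrow> (\<lambda>x. f x \<otimes> g x) \<in> S"
    and "\<And>f. f \<in> S \<Longrightarrow> (\<lambda>x. inv (f x)) \<in> S"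
  shows "comm_group (pw_group G S)"
proof (rule comm_groupI)
  fix f assume f: "f \<in> carrier (pw_group G S)"
  then have "f \<in> S" by (simp add: pw_group_def)
  moreover from this have "f x \<in> carrier G" for x using assms(1) by blast
  ultimately show "\<exists>g\<in>carrier (pw_group G S). g \<otimes>\<^bsub>pw_group G S\<^esub> f = \<one>\<^bsub>pw_group G S\<^esub>"
    using assms(4)[of f] by (intro bexI[of _ "\<lambda>x. inv (f x)"]) (auto simp: pw_group_def)
qed (use assms in \<open>auto simp: pw_group_def fun_eq_iff m_ac subset_iff\<close>)

section \<open>The two boundary operators\<close>

text \<open>The degree must be positive: \<open>or_bd\<close> is trivial in degree 0, whereas
  \<open>drop_head\<close> sends a one-entry tuple to the empty tuple, which is the
  augmentation.\<close>

lemma or_bd_eq_tensor_map: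
  assumes "f \<in> fin_chains G" "\<And>xs. f xs \<noteq> \<one> \<Longrightarrow> length xs = Suc n" "1 \<le> n"
  shows "or_bd G n f = tensor_map G drop_head f"
proof
  fix ys
  show "or_bd G n f ys = tensor_map G drop_head f ys"
  proof (cases "length ys = n")
    case True
    have "tensor_map G drop_head f = tensor_map G (\<lambda>xs. frag_of (tl xs)) f"
      using assms(1) by (rule tensor_map_cong) (auto simp: drop_head_def dest: assms(2))
    moreover have "{xs. f xs \<noteq> \<one> \<and> tl xs = ys} = (\<lambda>v. v # ys) ` {v. f (v # ys) \<noteq> \<one>}"
    proof -
      have "\<exists>v. xs = v # tl xs" if "f xs \<noteq> \<one>" for xs
        using assms(2)[OF that] by (cases xs) auto
      then show ?thesis by (auto simp: image_iff) (metis)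
    qed
    ultimately show ?thesis
      using True assms(3) tensor_map_frag_of_fibre[OF assms(1), of "\<lambda>v. v # ys" tl ys]
      by (simp add: or_bd_def inj_def)
  next
    case False
    have "tensor_map G drop_head f ys = \<one>"
    proof (rule ccontr)
      assume "\<not> ?thesis"
      then obtain xs where "f xs \<noteq> \<one>" "ys \<in> Poly_Mapping.keys (drop_head xs)"
        using tensor_map_support[OF assms(1), of _ ys] by auto
      with assms(2)[of xs] False show False by (auto simp: drop_head_def split: if_split_asm)
    qed
    with False show ?thesis by (simp add: or_bd_def)
  qed
qed

lemma delete_at_eq_iff:
  assumes "length xs = Suc n" "length ys = n" "i \<le> n"
  shows "take i xs @ drop (Suc i) xs = ys \<longleftrightarrow> (\<exists>v. xs = ins_at i v ys)"
proof
  assume ys: "take i xs @ drop (Suc i) xs = ys"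
  have "take i ys = take i xs" "drop i ys = drop (Suc i) xs"
    using assms by (auto simp: ys [symmetric])
  then have "xs = ins_at i (xs ! i) ys"
    using assms by (simp add: ins_at_def id_take_nth_drop)
  then show "\<exists>v. xs = ins_at i v ys" ..
next
  assume "\<exists>v. xs = ins_at i v ys"
  then show "take i xs @ drop (Suc i) xs = ys"
    using assms by (auto simp: ins_at_def)
qed

text \<open>The fibre of the \<open>i\<close>-th face map over \<open>ys\<close> consists of the
  insertions into \<open>ys\<close> at position \<open>i\<close>. Positive degree excludes the
  augmentation again.\<close>

lemma ord_bd_eq_tensor_map:
  assumes "f \<in> fin_chains G" "\<And>xs. f xs \<noteq> \<one> \<Longrightarrow> length xs = Suc n" "1 \<le> n"
  shows "ord_bd G n f = tensor_map G tuple_bd f"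
proof
  fix ys
  show "ord_bd G n f ys = tensor_map G tuple_bd f ys"
  proof (cases "length ys = n")
    case True
    let ?d = "\<lambda>i xs. take i xs @ drop (Suc i) xs"
    have "tensor_map G tuple_bd f =
        tensor_map G (\<lambda>xs. \<Sum>i\<in>{0..n}. frag_cmul ((-1) ^ i) (frag_of (?d i xs))) f"
      using assms(1,2)
      by (intro tensor_map_cong) (auto simp: tuple_bd_eq_sum atLeast0AtMost lessThan_Suc_atMost)
    then have "tensor_map G tuple_bd f ys =
        (\<Otimes>i\<in>{0..n}. tensor_map G (\<lambda>xs. frag_of (?d i xs)) f ys [^] ((-1) ^ i :: int))"
      by (simp add: tensor_map_sum[OF assms(1)] tensor_map_cmul[OF assms(1)])
    also have "\<dots> = (\<Otimes>i\<in>{0..n}. let s = \<Otimes>v\<in>{v. f (ins_at i v ys) \<noteq> \<one>}. f (ins_at i v ys)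
                            in if even i then s else inv s)"
    proof (intro finprod_cong')
      fix i assume i: "i \<in> {0..n}"
      let ?s = "\<Otimes>v\<in>{v. f (ins_at i v ys) \<noteq> \<one>}. f (ins_at i v ys)"
      have "?s \<in> carrier G" using assms(1) by (intro finprod_closed) (auto simp: fin_chains_def)
      moreover have "tensor_map G (\<lambda>xs. frag_of (?d i xs)) f ys = ?s"
      proof (rule tensor_map_frag_of_fibre[OF assms(1)])
        show "inj (\<lambda>v. ins_at i v ys)" by (simp add: inj_def ins_at_def)
        show "{xs. f xs \<noteq> \<one> \<and> ?d i xs = ys} = (\<lambda>v. ins_at i v ys) ` {v. f (ins_at i v ys) \<noteq> \<one>}"
        proof -
          have "?d i xs = ys \<longleftrightarrow> (\<exists>v. xs = ins_at i v ys)" if "f xs \<noteq> \<one>" for xs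
            using delete_at_eq_iff[OF assms(2)[OF that] True] i by simp
          then have "{xs. f xs \<noteq> \<one> \<and> ?d i xs = ys} = {xs. f xs \<noteq> \<one> \<and> (\<exists>v. xs = ins_at i v ys)}"
            by (intro Collect_cong conj_cong refl)
          then show ?thesis by auto
        qed
      qed
      ultimately show "tensor_map G (\<lambda>xs. frag_of (?d i xs)) f ys [^] ((-1) ^ i :: int) =
          (let s = ?s in if even i then s else inv s)"
        by (cases "even i") (simp_all add: Let_def int_pow_neg)
    qed (use assms(1) in \<open>auto simp: fin_chains_def Let_def\<close>)
    finally show ?thesis
      using True assms(3) by (simp add: ord_bd_def)
  next
    case False
    have "tensor_map G tuple_bd f ys = \<one>"
    proof (rule ccontr)
      assume "\<not> ?thesis"
      then obtain xs where "f xs \<noteq> \<one>" "ys \<in> Poly_Mapping.keys (tuple_bd xs)"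
        using tensor_map_support[OF assms(1), of _ ys] by auto
      with assms(2)[of xs] keys_tuple_bd[of ys xs] False show False by auto
    qed
    with False show ?thesis by (simp add: ord_bd_def)
  qed
qed

end

section \<open>Homology of complexes of coefficient functions\<close>

lemma pw_group_simps [simp]:
  "carrier (pw_group G S) = S"
  "f \<otimes>\<^bsub>pw_group G S\<^esub> g = (\<lambda>x. f x \<otimes>\<^bsub>G\<^esub> g x)"
  "\<one>\<^bsub>pw_group G S\<^esub> = (\<lambda>x. \<one>\<^bsub>G\<^esub>)"
  by (simp_all add: pw_group_def)

text \<open>Since no chain group lies below degree 0, \<open>d_closed\<close> speaks of successor
  degrees, and \<open>d_carrier\<close> provides the values of \<open>d 0\<close>.\<close>

locale coeff_complex = comm_group G for G :: "('a, 'm) monoid_scheme" (structure) +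
  fixes C :: "nat \<Rightarrow> ('b \<Rightarrow> 'a) set" and d :: "nat \<Rightarrow> ('b \<Rightarrow> 'a) \<Rightarrow> ('b \<Rightarrow> 'a)"
  assumes C_carrier: "f \<in> C n \<Longrightarrow> f x \<in> carrier G"
    and C_one: "(\<lambda>x. \<one>) \<in> C n"
    and C_mult: "f \<in> C n \<Longrightarrow> g \<in> C n \<Longrightarrow> (\<lambda>x. f x \<otimes> g x) \<in> C n"
    and C_inv: "f \<in> C n \<Longrightarrow> (\<lambda>x. inv (f x)) \<in> C n"
    and d_carrier: "f \<in> C n \<Longrightarrow> d n f x \<in> carrier G"
    and d_closed: "f \<in> C (Suc n) \<Longrightarrow> d (Suc n) f \<in> C n"
    and d_mult: "f \<in> C n \<Longrightarrow> g \<in> C n \<Longrightarrow> d n (\<lambda>x. f x \<otimes> g x) = (\<lambda>x. d n f x \<otimes> d n g x)"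
    and d_d: "f \<in> C (Suc n) \<Longrightarrow> d n (d (Suc n) f) = (\<lambda>x. \<one>)"
begin

abbreviation cycles :: "nat \<Rightarrow> ('b \<Rightarrow> 'a) set" where
  "cycles n \<equiv> {c \<in> C n. d n c = (\<lambda>x. \<one>)}"

abbreviation boundaries :: "nat \<Rightarrow> ('b \<Rightarrow> 'a) set" where
  "boundaries n \<equiv> d (Suc n) ` C (Suc n)"

lemma d_one: "d n (\<lambda>x. \<one>) = (\<lambda>x. \<one>)"
proof
  fix x
  have "d n (\<lambda>x. \<one>) x \<otimes> d n (\<lambda>x. \<one>) x = d n (\<lambda>x. \<one>) x"
    using fun_cong[OF d_mult[OF C_one C_one, of n], of x] by simp
  then show "d n (\<lambda>x. \<one>) x = \<one>"
    using d_carrier[OF C_one] by (simp add: l_cancel_one)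
qed

lemma d_inv:
  assumes "f \<in> C n"
  shows "d n (\<lambda>x. inv (f x)) = (\<lambda>x. inv (d n f x))"
proof
  fix x
  have "(\<lambda>x. inv (f x) \<otimes> f x) = (\<lambda>x. \<one>)"
    using C_carrier[OF assms] by simp
  then have "d n (\<lambda>x. inv (f x)) x \<otimes> d n f x = \<one>"
    using fun_cong[OF d_mult[OF C_inv[OF assms] assms], of x] by (simp add: d_one)
  then show "d n (\<lambda>x. inv (f x)) x = inv (d n f x)"
    using d_carrier[OF assms] d_carrier[OF C_inv[OF assms]] by (simp add: inv_equality)
qed

lemma cycles_comm_group: "comm_group (pw_group G (cycles n))"
  by (rule pw_group_comm_group) (auto simp: C_carrier C_one C_mult C_inv d_one d_mult d_inv)

lemma boundaries_subgroup: "subgroup (boundaries n) (pw_group G (cycles n))"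
proof -
  have "comm_group (pw_group G (C (Suc n)))"
    by (rule pw_group_comm_group) (auto simp: C_carrier C_one C_mult C_inv)
  moreover have "d (Suc n) \<in> hom (pw_group G (C (Suc n))) (pw_group G (cycles n))"
    by (rule homI) (auto simp: d_closed d_d d_mult)
  ultimately have "group_hom (pw_group G (C (Suc n))) (pw_group G (cycles n)) (d (Suc n))"
    using cycles_comm_group by (simp add: group_hom_def group_hom_axioms_def comm_group_def)
  then show ?thesis
    using group_hom.img_is_subgroup by fastforce
qed

lemma boundaries_normal: "boundaries n \<lhd> pw_group G (cycles n)"
  by (rule comm_group.subgroup_imp_normal[OF cycles_comm_group boundaries_subgroup])

lemma group_homology_of: "group (homology_of G C d n)"
  unfolding homology_of_def by (rule normal.factorgroup_is_group[OF boundaries_normal])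

end

text \<open>The first isomorphism theorem for the map that sends a cycle to the class of its image:
  it is onto by \<open>surj\<close>, and by \<open>inj\<close> its kernel consists of the
  boundaries. Surjectivity is required on cycles themselves, which a right inverse chain map
  provides.\<close>

lemma homology_of_iso:
  fixes G :: "('a, 'm) monoid_scheme" (structure)
    and C :: "nat \<Rightarrow> ('b \<Rightarrow> 'a) set" and C' :: "nat \<Rightarrow> ('c \<Rightarrow> 'a) set"
  assumes "coeff_complex G C d" "coeff_complex G C' d'"
    and a_closed: "\<And>n f. f \<in> C n \<Longrightarrow> a f \<in> C' n"
    and a_mult: "\<And>n f g. f \<in> C n \<Longrightarrow> g \<in> C n \<Longrightarrow> a (\<lambda>x. f x \<otimes> g x) = (\<lambda>x. a f x \<otimes> a g x)"
    and a_one: "a (\<lambda>x. \<one>) = (\<lambda>x. \<one>)"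
    and a_d: "\<And>n f. f \<in> C n \<Longrightarrow> d' n (a f) = a (d n f)"
    and surj: "\<And>n g. g \<in> C' n \<Longrightarrow> d' n g = (\<lambda>x. \<one>) \<Longrightarrow> \<exists>f\<in>C n. d n f = (\<lambda>x. \<one>) \<and> a f = g"
    and inj: "\<And>n f. f \<in> C n \<Longrightarrow> d n f = (\<lambda>x. \<one>) \<Longrightarrow> a f \<in> d' (Suc n) ` C' (Suc n) \<Longrightarrow>
                f \<in> d (Suc n) ` C (Suc n)"
  shows "homology_of G C d n \<cong> homology_of G C' d' n"
proof -
  interpret C: coeff_complex G C d by fact
  interpret C': coeff_complex G C' d' by fact
  let ?Z = "pw_group G (C.cycles n)" and ?Z' = "pw_group G (C'.cycles n)"
  let ?h = "(\<lambda>z. C'.boundaries n #>\<^bsub>?Z'\<^esub> z) \<circ> a"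
  interpret Z': comm_group ?Z' by (rule C'.cycles_comm_group)
  have a_hom: "a \<in> hom ?Z ?Z'"
    by (rule homI) (auto simp: a_closed a_d a_one intro: a_mult)
  have h_hom: "?h \<in> hom ?Z (?Z' Mod C'.boundaries n)"
    by (rule hom_compose[OF a_hom normal.r_coset_hom_Mod[OF C'.boundaries_normal]])
  interpret h: group_hom ?Z "?Z' Mod C'.boundaries n" ?h
    using h_hom C.cycles_comm_group normal.factorgroup_is_group[OF C'.boundaries_normal]
    by (simp add: group_hom_def group_hom_axioms_def comm_group_def)
  have a_image: "a ` C.cycles n = C'.cycles n"
    using surj by (auto simp: a_closed a_d a_one image_iff)
  then have "?h ` carrier ?Z = carrier (?Z' Mod C'.boundaries n)"
    unfolding image_comp [symmetric] by (auto simp: FactGroup_def RCOSETS_def)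
  moreover have "kernel ?Z (?Z' Mod C'.boundaries n) ?h = C.boundaries n"
  proof -
    have "?h f = C'.boundaries n \<longleftrightarrow> f \<in> C.boundaries n" if f: "f \<in> C.cycles n" for f
    proof -
      have af: "a f \<in> carrier ?Z'" using a_image f by auto
      have "?h f = C'.boundaries n \<longleftrightarrow> a f \<in> C'.boundaries n"
        using Z'.coset_join1[OF _ af C'.boundaries_subgroup] Z'.coset_join2[OF af C'.boundaries_subgroup] by auto
      also have "\<dots> \<longleftrightarrow> f \<in> C.boundaries n"
      proof
        assume "f \<in> C.boundaries n"
        then obtain g where "g \<in> C (Suc n)" "f = d (Suc n) g" by blast
        then show "a f \<in> C'.boundaries n" using a_d a_closed by (metis image_eqI)
      qed (use f inj in blast)
      finally show ?thesis .
    qed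
    moreover have "C.boundaries n \<subseteq> C.cycles n"
      using subgroup.subset[OF C.boundaries_subgroup] by simp
    ultimately show ?thesis
      by (auto simp: kernel_def FactGroup_def simp del: o_apply)
  qed
  ultimately show ?thesis
    using h.FactGroup_iso unfolding homology_of_def by metis
qed

section \<open>Ordered chains\<close>

definition tuple_chains :: "('a, 'm) monoid_scheme \<Rightarrow> ('v list \<Rightarrow> bool) \<Rightarrow> nat \<Rightarrow> ('v list \<Rightarrow> 'a) set" where
  "tuple_chains G P n = {f \<in> fin_chains G. \<forall>xs. f xs \<noteq> \<one>\<^bsub>G\<^esub> \<longrightarrow> length xs = Suc n \<and> P xs}"

lemma tuple_chainsD:
  assumes "f \<in> tuple_chains G P n"
  shows "f \<in> fin_chains G" "f xs \<noteq> \<one>\<^bsub>G\<^esub> \<Longrightarrow> length xs = Suc n" "f xs \<noteq> \<one>\<^bsub>G\<^esub> \<Longrightarrow> P xs"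
  using assms by (auto simp: tuple_chains_def)

lemma XU_chains_eq_tuple_chains:
  "XU_chains G S U n = tuple_chains G (\<lambda>xs. set xs \<subseteq> S \<and> sorted_wrt (\<lambda>x y. (x, y) \<in> U) xs) n"
  unfolding XU_chains_def tuple_chains_def fin_chains_def XU_simplices_def sorted_wrt_iff_nth_less
  by blast

context comm_group
begin

lemma tensor_map_tuple_chains:
  assumes "f \<in> tuple_chains G P n"
    and "\<And>xs ys. P xs \<Longrightarrow> length xs = Suc n \<Longrightarrow> ys \<in> Poly_Mapping.keys (\<phi> xs) \<Longrightarrow> length ys = Suc m \<and> Q ys"
  shows "tensor_map G \<phi> f \<in> tuple_chains G Q m"
proof -
  have "length ys = Suc m \<and> Q ys" if ne: "tensor_map G \<phi> f ys \<noteq> \<one>" for ys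
  proof -
    obtain xs where "f xs \<noteq> \<one>" "ys \<in> Poly_Mapping.keys (\<phi> xs)"
      using tensor_map_support[OF tuple_chainsD(1)[OF assms(1)] ne] by auto
    with assms(2)[of xs ys] tuple_chainsD(2,3)[OF assms(1), of xs] show ?thesis by simp
  qed
  with tensor_map_closed[OF tuple_chainsD(1)[OF assms(1)], of \<phi>] show ?thesis
    by (simp add: tuple_chains_def)
qed

lemma ord_bd_0: "ord_bd G 0 f = (\<lambda>ys. \<one>)"
  by (rule ext) (simp add: ord_bd_def)

lemma or_bd_0: "or_bd G 0 f = (\<lambda>ys. \<one>)"
  by (rule ext) (simp add: or_bd_def)

lemma ord_bd_Suc:
  "f \<in> tuple_chains G P (Suc n) \<Longrightarrow> ord_bd G (Suc n) f = tensor_map G tuple_bd f"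
  by (rule ord_bd_eq_tensor_map) (auto simp: tuple_chains_def)

lemma or_bd_Suc:
  "f \<in> tuple_chains G P (Suc n) \<Longrightarrow> or_bd G (Suc n) f = tensor_map G drop_head f"
  by (rule or_bd_eq_tensor_map) (auto simp: tuple_chains_def)

text \<open>The augmented boundary can produce the empty tuple, for which \<open>P\<close> may fail;
  hence the restriction on \<open>ys\<close>. The faces that matter, those of tuples with at least
  two entries, are nonempty.\<close>

lemma coeff_complex_tuple_chains:
  assumes face: "\<And>xs ys. P xs \<Longrightarrow> ys \<in> Poly_Mapping.keys (tuple_bd xs) \<Longrightarrow> ys \<noteq> [] \<Longrightarrow> P ys"
  shows "coeff_complex G (tuple_chains G P) (ord_bd G)"
proof unfold_locales
  fix f g n x
  show "(\<lambda>x. \<one>) \<in> tuple_chains G P n"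
    by (simp add: tuple_chains_def fin_chains_def)
  assume f: "f \<in> tuple_chains G P n"
  note f_fin = tuple_chainsD(1)[OF f]
  show "f x \<in> carrier G"
    by (rule fin_chainsD(1)[OF f_fin])
  have "inv (f x) \<noteq> \<one> \<longleftrightarrow> f x \<noteq> \<one>" for x
    using fin_chainsD(1)[OF f_fin] by (simp add: inv_eq_1_iff)
  with f show "(\<lambda>x. inv (f x)) \<in> tuple_chains G P n"
    by (simp add: tuple_chains_def fin_chains_def)
  show "ord_bd G n f x \<in> carrier G"
    by (cases n) (use f fin_chainsD(1)[OF tensor_map_closed[OF f_fin]] in \<open>auto simp: ord_bd_0 ord_bd_Suc\<close>)
  assume g: "g \<in> tuple_chains G P n"
  note g_fin = tuple_chainsD(1)[OF g]
  have sub: "{x. f x \<otimes> g x \<noteq> \<one>} \<subseteq> {x. f x \<noteq> \<one>} \<union> {x. g x \<noteq> \<one>}"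
    by auto
  moreover have "finite ({x. f x \<noteq> \<one>} \<union> {x. g x \<noteq> \<one>})"
    using fin_chainsD(2)[OF f_fin] fin_chainsD(2)[OF g_fin] by simp
  ultimately have "finite {x. f x \<otimes> g x \<noteq> \<one>}"
    by (rule finite_subset)
  then have "(\<lambda>x. f x \<otimes> g x) \<in> fin_chains G"
    using f_fin g_fin by (simp add: fin_chains_def)
  with f g sub show fg: "(\<lambda>x. f x \<otimes> g x) \<in> tuple_chains G P n"
    unfolding tuple_chains_def by blast
  show "ord_bd G n (\<lambda>x. f x \<otimes> g x) = (\<lambda>x. ord_bd G n f x \<otimes> ord_bd G n g x)"
  proof (cases n)
    case 0
    then show ?thesis by (simp add: ord_bd_0)
  next
    case (Suc m)
    with f g fg show ?thesis
      by (simp add: ord_bd_Suc tensor_map_mult[OF f_fin g_fin])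
  qed
next
  fix f n
  assume f: "f \<in> tuple_chains G P (Suc n)"
  have closed: "tensor_map G tuple_bd f \<in> tuple_chains G P n"
  proof (rule tensor_map_tuple_chains[OF f])
    fix xs ys assume "P xs" "length xs = Suc (Suc n)" "ys \<in> Poly_Mapping.keys (tuple_bd xs)"
    moreover from this have "length ys = Suc n"
      using keys_tuple_bd[of ys xs] by simp
    moreover from this have "ys \<noteq> []" by auto
    ultimately show "length ys = Suc n \<and> P ys"
      using face[of xs ys] by simp
  qed
  then show "ord_bd G (Suc n) f \<in> tuple_chains G P n"
    by (simp add: ord_bd_Suc[OF f])
  show "ord_bd G n (ord_bd G (Suc n) f) = (\<lambda>x. \<one>)"
  proof (cases n)
    case 0
    then show ?thesis by (simp add: ord_bd_0)
  next
    case (Suc m)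
    then have "ord_bd G n (ord_bd G (Suc n) f) = tensor_map G tuple_bd (tensor_map G tuple_bd f)"
      using closed ord_bd_Suc[of "tensor_map G tuple_bd f" P m] ord_bd_Suc[OF f] by simp
    also have "\<dots> = (\<lambda>x. \<one>)"
      by (simp add: tensor_map_comp[OF tuple_chainsD(1)[OF f]] tuple_bd_tuple_bd tensor_map_zero)
    finally show ?thesis .
  qed
qed

lemma coeff_complex_XU_chains: "coeff_complex G (XU_chains G S U) (ord_bd G)"
  unfolding XU_chains_eq_tuple_chains
proof (rule coeff_complex_tuple_chains)
  fix xs ys :: "'c list"
  assume "set xs \<subseteq> S \<and> sorted_wrt (\<lambda>x y. (x, y) \<in> U) xs" "ys \<in> Poly_Mapping.keys (tuple_bd xs)"
  with keys_tuple_bd[of ys xs "\<lambda>x y. (x, y) \<in> U"]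
  show "set ys \<subseteq> S \<and> sorted_wrt (\<lambda>x y. (x, y) \<in> U) ys" by auto
qed

section \<open>The limit over a filter with a least entourage\<close>

abbreviation XU_cycles :: "'v set \<Rightarrow> 'v rel \<Rightarrow> nat \<Rightarrow> ('v list \<Rightarrow> 'a) set" where
  "XU_cycles S U n \<equiv> {c \<in> XU_chains G S U n. ord_bd G n c = (\<lambda>x. \<one>)}"

abbreviation XU_class :: "'v set \<Rightarrow> 'v rel \<Rightarrow> nat \<Rightarrow> ('v list \<Rightarrow> 'a) \<Rightarrow> ('v list \<Rightarrow> 'a) set" where
  "XU_class S U n z \<equiv>
     (ord_bd G (Suc n) ` XU_chains G S U (Suc n)) #>\<^bsub>pw_group G (XU_cycles S U n)\<^esub> z"

lemma carrier_XU_homology: "carrier (XU_homology G S U n) = XU_class S U n ` XU_cycles S U n"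
  by (auto simp: XU_homology_def homology_of_def FactGroup_def RCOSETS_def)

lemma XU_class_mult:
  assumes "z \<in> XU_cycles S U n" "w \<in> XU_cycles S U n"
  shows "XU_class S U n z \<otimes>\<^bsub>XU_homology G S U n\<^esub> XU_class S U n w = XU_class S U n (\<lambda>x. z x \<otimes> w x)"
proof -
  interpret coeff_complex G "XU_chains G S U" "ord_bd G" by (rule coeff_complex_XU_chains)
  show ?thesis
    using normal.rcos_sum[OF boundaries_normal, of z n w] assms
    by (simp add: XU_homology_def homology_of_def FactGroup_def)
qed

lemma XU_chains_mono: "U' \<subseteq> U \<Longrightarrow> XU_chains G S U' n \<subseteq> XU_chains G S U n"
  by (auto simp: XU_chains_eq_tuple_chains tuple_chains_def elim!: sorted_wrt_mono_rel [rotated])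

text \<open>The boundaries for \<open>U'\<close> are among those for \<open>U\<close>, so
  multiplying the smaller coset by the larger boundary group absorbs it into the coset of the same
  cycle.\<close>

lemma XU_restr_class:
  assumes "U' \<subseteq> U" "z \<in> XU_cycles S U' n"
  shows "XU_restr G S U n (XU_class S U' n z) = XU_class S U n z"
proof -
  interpret coeff_complex G "XU_chains G S U" "ord_bd G" by (rule coeff_complex_XU_chains)
  interpret C': coeff_complex G "XU_chains G S U'" "ord_bd G" by (rule coeff_complex_XU_chains)
  interpret B: subgroup "boundaries n" "pw_group G (cycles n)" by (rule boundaries_subgroup)
  have B'B: "C'.boundaries n \<subseteq> boundaries n"
    using XU_chains_mono[OF assms(1)] by blast
  have one: "(\<lambda>x. \<one>) \<in> C'.boundaries n"
    using subgroup.one_closed[OF C'.boundaries_subgroup] by simp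
  have z: "z x \<in> carrier G" for x
    using C'.C_carrier assms(2) by blast
  have B: "b x \<in> carrier G" if "b \<in> boundaries n" for b x
    using B.mem_carrier[OF that] C_carrier by simp blast
  show ?thesis
  proof
    show "XU_restr G S U n (XU_class S U' n z) \<subseteq> XU_class S U n z"
    proof
      fix f assume "f \<in> XU_restr G S U n (XU_class S U' n z)"
      then obtain b b' where b: "b \<in> boundaries n" "b' \<in> C'.boundaries n"
          and f: "f = (\<lambda>x. b x \<otimes> (b' x \<otimes> z x))"
        unfolding XU_restr_def set_mult_def r_coset_def by auto
      with B'B have b': "b' \<in> boundaries n" by blast
      have "f = (\<lambda>x. (b x \<otimes> b' x) \<otimes> z x)"
        unfolding f using B[OF b(1)] B[OF b'] z by (simp add: m_assoc)
      moreover have "(\<lambda>x. b x \<otimes> b' x) \<in> boundaries n"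
        using B.m_closed[OF b(1) b'] by simp
      ultimately show "f \<in> XU_class S U n z"
        unfolding r_coset_def pw_group_simps by blast
    qed
    show "XU_class S U n z \<subseteq> XU_restr G S U n (XU_class S U' n z)"
    proof
      fix f assume "f \<in> XU_class S U n z"
      then obtain b where b: "b \<in> boundaries n" "f = (\<lambda>x. b x \<otimes> z x)"
        unfolding r_coset_def pw_group_simps by blast
      then have "f = (\<lambda>x. b x \<otimes> (\<one> \<otimes> z x))"
        using z by simp
      with b(1) one show "f \<in> XU_restr G S U n (XU_class S U' n z)"
        unfolding XU_restr_def set_mult_def r_coset_def pw_group_simps by blast
    qed
  qed
qed

text \<open>In the order by reverse inclusion \<open>U0\<close> is the greatest index, so a
  compatible family is determined by its value there and every value extends to a family.\<close>

lemma VR_homology_least_entourage: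
  assumes "U0 \<in> UU" and least: "\<And>U. U \<in> UU \<Longrightarrow> U0 \<subseteq> U"
  shows "XU_homology G S U0 n \<cong> VR_homology G S UU n"
proof -
  let ?h = "\<lambda>c. \<lambda>U\<in>UU. XU_restr G S U n c"
  have h_class: "?h (XU_class S U0 n z) = (\<lambda>U\<in>UU. XU_class S U n z)" if "z \<in> XU_cycles S U0 n" for z
    by (rule restrict_ext) (rule XU_restr_class[OF least that])
  \<comment> \<open>The differential does not refer to the entourage, so a cycle stays one when the
    entourage grows.\<close>
  have cycle: "z \<in> XU_cycles S U n" if "z \<in> XU_cycles S U0 n" "U \<in> UU" for z U
    using that XU_chains_mono[OF least[OF that(2)], of S n] by auto
  have h_closed: "?h (XU_class S U0 n z) \<in> carrier (VR_homology G S UU n)" if z: "z \<in> XU_cycles S U0 n" for z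
    unfolding h_class[OF z] VR_homology_def
    using cycle[OF z] by (simp add: carrier_XU_homology XU_restr_class)
  have "?h \<in> hom (XU_homology G S U0 n) (VR_homology G S UU n)"
  proof (rule homI)
    fix c e assume "c \<in> carrier (XU_homology G S U0 n)" "e \<in> carrier (XU_homology G S U0 n)"
    then obtain z w where z: "z \<in> XU_cycles S U0 n" "c = XU_class S U0 n z"
      and w: "w \<in> XU_cycles S U0 n" "e = XU_class S U0 n w"
      unfolding carrier_XU_homology by blast
    interpret coeff_complex G "XU_chains G S U0" "ord_bd G" by (rule coeff_complex_XU_chains)
    have zw: "(\<lambda>x. z x \<otimes> w x) \<in> XU_cycles S U0 n"
      using z(1) w(1) by (simp add: C_mult d_mult)
    have "?h (c \<otimes>\<^bsub>XU_homology G S U0 n\<^esub> e) = (\<lambda>U\<in>UU. XU_class S U n (\<lambda>x. z x \<otimes> w x))"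
      unfolding z(2) w(2) XU_class_mult[OF z(1) w(1)] by (rule h_class[OF zw])
    also have "\<dots> = (\<lambda>U\<in>UU. XU_class S U n z \<otimes>\<^bsub>XU_homology G S U n\<^esub> XU_class S U n w)"
      by (rule restrict_ext) (rule XU_class_mult[symmetric], rule cycle[OF z(1)], assumption, rule cycle[OF w(1)])
    also have "\<dots> = ?h c \<otimes>\<^bsub>VR_homology G S UU n\<^esub> ?h e"
      unfolding z(2) w(2) h_class[OF z(1)] h_class[OF w(1)]
      by (simp add: VR_homology_def cong: restrict_cong)
    finally show "?h (c \<otimes>\<^bsub>XU_homology G S U0 n\<^esub> e) = ?h c \<otimes>\<^bsub>VR_homology G S UU n\<^esub> ?h e" .
  qed (use h_closed in \<open>auto simp: carrier_XU_homology\<close>)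
  moreover have "bij_betw ?h (carrier (XU_homology G S U0 n)) (carrier (VR_homology G S UU n))"
  proof (rule bij_betw_byWitness[where f' = "\<lambda>k. k U0"])
    show "\<forall>c\<in>carrier (XU_homology G S U0 n). ?h c U0 = c"
      using assms(1) by (auto simp: carrier_XU_homology XU_restr_class)
    show "\<forall>k\<in>carrier (VR_homology G S UU n). ?h (k U0) = k"
    proof
      fix k assume "k \<in> carrier (VR_homology G S UU n)"
      then have k: "k \<in> extensional UU" "\<And>U. U \<in> UU \<Longrightarrow> XU_restr G S U n (k U0) = k U"
        using assms by (auto simp: VR_homology_def PiE_def)
      then show "?h (k U0) = k" by (auto simp: fun_eq_iff restrict_def extensional_def)
    qed
    show "?h ` carrier (XU_homology G S U0 n) \<subseteq> carrier (VR_homology G S UU n)"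
      using h_closed by (auto simp: carrier_XU_homology)
    show "(\<lambda>k. k U0) ` carrier (VR_homology G S UU n) \<subseteq> carrier (XU_homology G S U0 n)"
      using assms(1) by (auto simp: VR_homology_def)
  qed
  ultimately show ?thesis
    by (auto simp: is_iso_def iso_def)
qed

end

section \<open>Ordered versus oriented chains\<close>

text \<open>Insertion sort turned into an induction rule: adjacent transpositions lead from any
  tuple to an ascending one, unless two equal entries meet on the way.\<close>

lemma (in strict_total_order) sort_induct:
  assumes swap: "\<And>us x y vs. E (us @ y # x # vs) \<Longrightarrow> E (us @ x # y # vs)"
    and asc: "\<And>xs. ascending xs \<Longrightarrow> E xs"
    and rep: "\<And>xs. \<not> distinct xs \<Longrightarrow> E xs"
  shows "E xs"
proof -
  \<comment> \<open>One insertion behind a fixed prefix \<open>us\<close>. Each entry that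
    \<open>x\<close> passes joins the prefix.\<close>
  have ins: "E (us @ x # ys)"
    if "ascending ys" "\<And>zs. ascending zs \<Longrightarrow> set zs = set (x # ys) \<Longrightarrow> E (us @ zs)" for us x ys
    using that
  proof (induction ys arbitrary: us)
    case Nil
    then show ?case by simp
  next
    case (Cons y ys)
    consider "x \<lless> y" | "x = y" | "y \<lless> x" using total by blast
    then show ?case
    proof cases
      case 1
      then have "ascending (x # y # ys)"
        using Cons.prems(1) trans by auto
      then show ?thesis by (rule Cons.prems(2)) simp
    next
      case 2
      then show ?thesis by (intro rep) simp
    next
      case 3
      have "E ((us @ [y]) @ x # ys)"
      proof (rule Cons.IH)
        show "ascending ys" using Cons.prems(1) by simp
        fix zs assume zs: "ascending zs" "set zs = set (x # ys)"
        then have "E (us @ (y # zs))"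
          using Cons.prems(1) 3 by (intro Cons.prems(2)) auto
        then show "E ((us @ [y]) @ zs)" by simp
      qed
      then have "E (us @ y # x # ys)" by simp
      then show ?thesis by (rule swap)
    qed
  qed
  have "E (us @ xs)" if "\<And>zs. ascending zs \<Longrightarrow> set zs = set xs \<Longrightarrow> E (us @ zs)" for us xs
    using that
  proof (induction xs arbitrary: us)
    case (Cons x xs)
    have "E ((us @ [x]) @ xs)"
    proof (rule Cons.IH)
      fix zs assume zs: "ascending zs" "set zs = set xs"
      have "E (us @ x # zs)"
        using zs(1) by (rule ins) (use zs(2) Cons.prems in simp)
      then show "E ((us @ [x]) @ zs)" by simp
    qed
    then show ?case by simp
  qed simp
  from this[of xs "[]"] asc show ?thesis by simp
qed

locale complex_comparison = comm_group G + strict_total_order lt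
  for G :: "('a, 'm) monoid_scheme" (structure) and lt :: "'v \<Rightarrow> 'v \<Rightarrow> bool"  (infix "\<lless>" 50) +
  fixes K :: "'v set set"
  assumes K_face: "s \<in> K \<Longrightarrow> t \<subseteq> s \<Longrightarrow> t \<noteq> {} \<Longrightarrow> t \<in> K"
begin

abbreviation ordered :: "nat \<Rightarrow> ('v list \<Rightarrow> 'a) set" where
  "ordered \<equiv> tuple_chains G (\<lambda>xs. set xs \<in> K)"

abbreviation antisym_map :: "('v list \<Rightarrow> 'a) \<Rightarrow> ('v list \<Rightarrow> 'a)" where
  "antisym_map \<equiv> tensor_map G antisymmetrize"

abbreviation ascending_map :: "('v list \<Rightarrow> 'a) \<Rightarrow> ('v list \<Rightarrow> 'a)" where
  "ascending_map \<equiv> tensor_map G keep_ascending"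

sublocale ordered: coeff_complex G ordered "ord_bd G"
proof (rule coeff_complex_tuple_chains)
  fix xs ys assume "set xs \<in> K" "ys \<in> Poly_Mapping.keys (tuple_bd xs)" "ys \<noteq> []"
  with keys_tuple_bd[of ys xs] K_face[of "set xs" "set ys"] show "set ys \<in> K" by simp
qed

lemma or_chains_iff:
  "f \<in> or_chains G K n \<longleftrightarrow> f \<in> ordered n \<and> (\<forall>xs. f xs \<noteq> \<one> \<longrightarrow> distinct xs) \<and>
     (\<forall>xs i j. i < length xs \<longrightarrow> j < length xs \<longrightarrow> i \<noteq> j \<longrightarrow> f (xs[i := xs ! j, j := xs ! i]) = inv (f xs))"
  unfolding or_chains_def tuple_chains_def fin_chains_def by blast

lemma or_chains_ordered: "f \<in> or_chains G K n \<Longrightarrow> f \<in> ordered n"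
  by (simp add: or_chains_iff)

lemma or_chains_swap_adjacent:
  assumes "f \<in> or_chains G K n"
  shows "f (us @ x # y # vs) = inv (f (us @ y # x # vs))"
proof -
  let ?xs = "us @ y # x # vs" and ?i = "length us"
  have "f (?xs[?i := ?xs ! Suc ?i, Suc ?i := ?xs ! ?i]) = inv (f ?xs)"
    by (rule assms[unfolded or_chains_iff, THEN conjunct2, THEN conjunct2, rule_format]) auto
  moreover have "?xs[?i := ?xs ! Suc ?i, Suc ?i := ?xs ! ?i] = us @ x # y # vs"
    by (simp add: nth_append list_update_append)
  ultimately show ?thesis by simp
qed

text \<open>By \<open>sort_induct\<close>: transpositions invert both values alike, and both are
  trivial at tuples with a repeated entry.\<close>

lemma or_chains_eqI:
  assumes "f \<in> or_chains G K n" "g \<in> or_chains G K n" "\<And>xs. ascending xs \<Longrightarrow> f xs = g xs"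
  shows "f = g"
proof
  fix xs
  show "f xs = g xs"
  proof (induction xs rule: sort_induct)
    case (1 us x y vs)
    then show ?case
      using or_chains_swap_adjacent[OF assms(1)] or_chains_swap_adjacent[OF assms(2)] by metis
  next
    case (3 xs)
    then show ?case using assms(1,2) unfolding or_chains_iff by metis
  qed (rule assms(3))
qed

lemma antisym_map_closed:
  assumes "f \<in> ordered n"
  shows "antisym_map f \<in> or_chains G K n"
proof -
  note f_fin = tuple_chainsD(1)[OF assms]
  have alt: "antisym_map f (xs[i := xs ! j, j := xs ! i]) = inv (antisym_map f xs)"
    if "i < length xs" "j < length xs" "i \<noteq> j" for xs i j
  proof -
    \<comment> \<open>Transposing entries negates the integral coefficient at \<open>xs\<close> for
      every source tuple, so the sign leaves the matrix as the power -1.\<close>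
    have "antisym_map f (xs[i := xs ! j, j := xs ! i]) = tensor_map G (\<lambda>x. frag_cmul (-1) (antisymmetrize x)) f xs"
      unfolding tensor_map_def using alternating_swap[OF alternating_antisymmetrize that] by simp
    also have "\<dots> = antisym_map f xs [^] (-1 :: int)"
      by (rule tensor_map_cmul[OF f_fin])
    also have "\<dots> = inv (antisym_map f xs)"
      using int_pow_neg[OF fin_chainsD(1)[OF tensor_map_closed[OF f_fin]], of antisymmetrize xs 1]
        fin_chainsD(1)[OF tensor_map_closed[OF f_fin], of antisymmetrize xs] by simp
    finally show ?thesis .
  qed
  have "antisym_map f \<in> ordered n"
  proof (rule tensor_map_tuple_chains[OF assms])
    fix xs ys :: "'v list"
    assume "set xs \<in> K" "length xs = Suc n" "ys \<in> Poly_Mapping.keys (antisymmetrize xs)"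
    moreover from keys_antisymmetrize[OF this(3)] have "length ys = length xs" "set ys = set xs"
      by (rule mset_eq_length, rule mset_eq_setD)
    ultimately show "length ys = Suc n \<and> set ys \<in> K" by simp
  qed
  moreover have "distinct ys" if ne: "antisym_map f ys \<noteq> \<one>" for ys
  proof -
    obtain xs where "ys \<in> Poly_Mapping.keys (antisymmetrize xs)"
      using tensor_map_support[OF f_fin ne] by auto
    then show ?thesis
      using alternating_not_distinct[OF alternating_antisymmetrize, of ys xs] by (auto simp: in_keys_iff)
  qed
  ultimately show ?thesis
    using alt unfolding or_chains_iff by blast
qed

lemma ascending_map_apply:
  assumes "f \<in> fin_chains G"
  shows "ascending_map f xs = (if ascending xs then f xs else \<one>)"
proof -
  have "Poly_Mapping.lookup (keep_ascending x) xs = (if ascending xs then Poly_Mapping.lookup (frag_of x) xs else 0)" for x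
    by (auto simp: keep_ascending_def)
  then have "ascending_map f xs = (if ascending xs then tensor_map G frag_of f xs else \<one>)"
    unfolding tensor_map_def by simp
  then show ?thesis by (simp add: tensor_map_frag_of[OF assms])
qed

lemma ascending_map_closed:
  assumes "f \<in> ordered n"
  shows "ascending_map f \<in> ordered n"
proof (rule tensor_map_tuple_chains[OF assms])
  fix xs ys assume "set xs \<in> K" "length xs = Suc n" "ys \<in> Poly_Mapping.keys (keep_ascending xs)"
  then show "length ys = Suc n \<and> set ys \<in> K"
    by (auto simp: keep_ascending_def split: if_split_asm)
qed

lemma antisym_map_bd:
  assumes "f \<in> ordered n"
  shows "or_bd G n (antisym_map f) = antisym_map (ord_bd G n f)"
proof (cases n)
  case 0
  then show ?thesis by (simp add: or_bd_0 ord_bd_0)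
next
  case (Suc m)
  have "antisym_map f \<in> ordered (Suc m)"
    using or_chains_ordered[OF antisym_map_closed[OF assms]] Suc by simp
  then have "or_bd G n (antisym_map f) = tensor_map G drop_head (antisym_map f)"
    unfolding Suc by (rule or_bd_Suc)
  also have "\<dots> = antisym_map (tensor_map G tuple_bd f)"
    using tuple_chainsD(1)[OF assms] by (simp add: tensor_map_comp antisymmetrize_tuple_bd)
  also have "tensor_map G tuple_bd f = ord_bd G n f"
    using assms unfolding Suc by (rule ord_bd_Suc[symmetric])
  finally show ?thesis .
qed

lemma sort_map_eq:
  assumes "f \<in> fin_chains G"
  shows "ascending_map (antisym_map f) = tensor_map G sort_signed f"
  using assms by (simp add: tensor_map_comp keep_ascending_antisymmetrize)

lemma sort_map_ascending_map:
  assumes "f \<in> fin_chains G"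
  shows "tensor_map G sort_signed (ascending_map f) = ascending_map f"
proof -
  have "tensor_map G sort_signed (ascending_map f) = tensor_map G frag_of (ascending_map f)"
    by (rule tensor_map_cong[OF tensor_map_closed[OF assms]])
       (auto simp: ascending_map_apply[OF assms] sort_signed_ascending split: if_split_asm)
  then show ?thesis by (simp add: tensor_map_frag_of tensor_map_closed assms)
qed

text \<open>Two alternating chains are compared, so ascending tuples suffice. There the composite is
  signed sorting, which fixes chains supported on ascending tuples.\<close>

lemma antisym_map_ascending_map:
  assumes "f \<in> or_chains G K n"
  shows "antisym_map (ascending_map f) = f"
proof (rule or_chains_eqI[OF _ assms])
  note f = or_chains_ordered[OF assms]
  note f_fin = tuple_chainsD(1)[OF f]
  show "antisym_map (ascending_map f) \<in> or_chains G K n"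
    by (rule antisym_map_closed[OF ascending_map_closed[OF f]])
  fix xs assume xs: "ascending xs"
  then have "antisym_map (ascending_map f) xs = ascending_map (antisym_map (ascending_map f)) xs"
    by (simp add: ascending_map_apply tensor_map_closed f_fin)
  also have "\<dots> = ascending_map f xs"
    by (simp add: sort_map_eq sort_map_ascending_map tensor_map_closed f_fin)
  also have "\<dots> = f xs"
    using xs by (simp add: ascending_map_apply f_fin)
  finally show "antisym_map (ascending_map f) xs = f xs" .
qed

text \<open>Signed sorting \<open>p\<close> is a chain map fixing \<open>ascending_map f\<close>, so
  it fixes the boundary of that chain too. Factoring \<open>p\<close> as
  \<open>ascending_map\<close> after \<open>antisym_map\<close> and moving the boundary through
  \<open>antisym_map\<close> gives the claim.\<close>

lemma ascending_map_bd:
  assumes "f \<in> or_chains G K n"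
  shows "ord_bd G n (ascending_map f) = ascending_map (or_bd G n f)"
proof (cases n)
  case 0
  then show ?thesis by (simp add: or_bd_0 ord_bd_0)
next
  case (Suc m)
  let ?g = "ascending_map f"
  note f = or_chains_ordered[OF assms]
  have g: "?g \<in> ordered n" by (rule ascending_map_closed[OF f])
  note g_fin = tuple_chainsD(1)[OF g]
  have bd: "ord_bd G n ?g = tensor_map G tuple_bd ?g"
    using g unfolding Suc by (rule ord_bd_Suc)
  also have "\<dots> = tensor_map G tuple_bd (tensor_map G sort_signed ?g)"
    by (simp add: sort_map_ascending_map tuple_chainsD(1)[OF f])
  also have "\<dots> = tensor_map G sort_signed (tensor_map G tuple_bd ?g)"
    by (simp add: tensor_map_comp[OF g_fin] tuple_bd_sort_signed)
  also have "\<dots> = ascending_map (antisym_map (ord_bd G n ?g))"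
    by (simp add: bd sort_map_eq tensor_map_closed[OF g_fin])
  also have "antisym_map (ord_bd G n ?g) = or_bd G n f"
    by (simp add: antisym_map_bd[OF g, symmetric] antisym_map_ascending_map[OF assms])
  finally show ?thesis .
qed

lemma sort_homotopy_closed:
  "f \<in> ordered n \<Longrightarrow> tensor_map G sort_homotopy f \<in> ordered (Suc n)"
proof (rule tensor_map_tuple_chains)
  fix xs ys assume "set xs \<in> K" "length xs = Suc n" "ys \<in> Poly_Mapping.keys (sort_homotopy xs)"
  moreover from this have "length ys = Suc (Suc n)" "set ys \<subseteq> set xs"
    using keys_sort_homotopy[of ys xs] by auto
  moreover from this have "set ys \<noteq> {}" by auto
  ultimately show "length ys = Suc (Suc n) \<and> set ys \<in> K"
    using K_face[of "set xs" "set ys"] by simp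
qed

lemma cycle_homologous_sort:
  assumes f: "f \<in> ordered n" and cycle: "ord_bd G n f = (\<lambda>x. \<one>)"
  shows "f = (\<lambda>x. tensor_map G sort_signed f x \<otimes> ord_bd G (Suc n) (tensor_map G sort_homotopy f) x)"
proof -
  note f_fin = tuple_chainsD(1)[OF f]
  have h_bd: "tensor_map G (\<lambda>xs. frag_extend sort_homotopy (tuple_bd xs)) f = (\<lambda>x. \<one>)"
  proof (cases n)
    case 0
    \<comment> \<open>In degree 0 every chain is a cycle, yet \<open>tuple_bd\<close> of a one-entry
      tuple is \<open>frag_of []\<close>. The discrepancy is harmless because
      \<open>sort_homotopy [] = 0\<close>.\<close>
    have "frag_extend sort_homotopy (tuple_bd xs) = 0" if "f xs \<noteq> \<one>" for xs
      using tuple_chainsD(2)[OF f that] 0 by (cases xs) auto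
    then have "tensor_map G (\<lambda>xs. frag_extend sort_homotopy (tuple_bd xs)) f = tensor_map G (\<lambda>_. 0) f"
      by (rule tensor_map_cong[OF f_fin])
    then show ?thesis by (simp only: tensor_map_zero)
  next
    case (Suc m)
    then have "tensor_map G tuple_bd f = (\<lambda>x. \<one>)"
      using f cycle by (simp add: ord_bd_Suc)
    then show ?thesis by (simp add: tensor_map_comp[OF f_fin, symmetric])
  qed
  have "f = tensor_map G (\<lambda>xs. sort_signed xs + (frag_extend tuple_bd (sort_homotopy xs)
      + frag_extend sort_homotopy (tuple_bd xs))) f"
    by (simp add: sort_homotopy tensor_map_frag_of[OF f_fin])
  also have "\<dots> = (\<lambda>x. tensor_map G sort_signed f x \<otimes> tensor_map G tuple_bd (tensor_map G sort_homotopy f) x)"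
    using fin_chainsD(1)[OF tensor_map_closed[OF f_fin, of "\<lambda>xs. tuple_bd_ext (sort_homotopy xs)"]]
    by (simp add: tensor_map_add[OF f_fin] h_bd tensor_map_comp[OF f_fin])
  finally show ?thesis
    by (simp add: ord_bd_Suc[OF sort_homotopy_closed[OF f]])
qed

lemma coeff_complex_or_chains: "coeff_complex G (or_chains G K) (or_bd G)"
proof unfold_locales
  fix f g n x
  show "(\<lambda>x. \<one>) \<in> or_chains G K n"
    by (simp add: or_chains_iff ordered.C_one)
  assume f: "f \<in> or_chains G K n"
  note f_ord = or_chains_ordered[OF f]
  note f_fin = tuple_chainsD(1)[OF f_ord]
  note f_car = fin_chainsD(1)[OF f_fin]
  show "f x \<in> carrier G" by (rule f_car)
  show "(\<lambda>x. inv (f x)) \<in> or_chains G K n"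
    using f f_car ordered.C_inv[OF f_ord] by (auto simp: or_chains_iff inv_eq_1_iff)
  show "or_bd G n f x \<in> carrier G"
    by (cases n) (use f_ord fin_chainsD(1)[OF tensor_map_closed[OF f_fin]] in \<open>auto simp: or_bd_0 or_bd_Suc\<close>)
  assume g: "g \<in> or_chains G K n"
  note g_ord = or_chains_ordered[OF g]
  note g_fin = tuple_chainsD(1)[OF g_ord]
  note fg_ord = ordered.C_mult[OF f_ord g_ord]
  have "distinct xs" if "f xs \<otimes> g xs \<noteq> \<one>" for xs
  proof -
    have "f xs \<noteq> \<one> \<or> g xs \<noteq> \<one>" using that by auto
    then show ?thesis using f g unfolding or_chains_iff by blast
  qed
  then show "(\<lambda>x. f x \<otimes> g x) \<in> or_chains G K n"
    using f g fg_ord f_car fin_chainsD(1)[OF g_fin] unfolding or_chains_iff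
    by (auto simp: inv_mult)
  show "or_bd G n (\<lambda>x. f x \<otimes> g x) = (\<lambda>x. or_bd G n f x \<otimes> or_bd G n g x)"
  proof (cases n)
    case 0
    then show ?thesis by (simp add: or_bd_0)
  next
    case (Suc m)
    then show ?thesis
      using f_ord g_ord fg_ord by (simp add: or_bd_Suc tensor_map_mult[OF f_fin g_fin])
  qed
next
  fix f n assume f: "f \<in> or_chains G K (Suc n)"
  let ?g = "ascending_map f"
  have g: "?g \<in> ordered (Suc n)"
    by (rule ascending_map_closed[OF or_chains_ordered[OF f]])
  \<comment> \<open>Writing \<open>f\<close> as the antisymmetrisation of an ordered chain transfers
    closure and vanishing of the double boundary from the ordered complex.\<close>
  have bd: "or_bd G (Suc n) f = antisym_map (ord_bd G (Suc n) ?g)"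
    by (simp add: antisym_map_bd[OF g, symmetric] antisym_map_ascending_map[OF f])
  show "or_bd G (Suc n) f \<in> or_chains G K n"
    unfolding bd by (rule antisym_map_closed[OF ordered.d_closed[OF g]])
  show "or_bd G n (or_bd G (Suc n) f) = (\<lambda>x. \<one>)"
    unfolding bd by (simp add: antisym_map_bd[OF ordered.d_closed[OF g]] ordered.d_d[OF g])
qed

lemma ordered_homology_iso_simplicial_homology:
  "homology_of G ordered (ord_bd G) n \<cong> simplicial_homology G K n"
  unfolding simplicial_homology_def
proof (rule homology_of_iso[where a = antisym_map])
  fix n f
  assume f: "f \<in> ordered n"
  show "antisym_map f \<in> or_chains G K n" by (rule antisym_map_closed[OF f])
  show "or_bd G n (antisym_map f) = antisym_map (ord_bd G n f)" by (rule antisym_map_bd[OF f])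
  fix g assume g: "g \<in> ordered n"
  show "antisym_map (\<lambda>x. f x \<otimes> g x) = (\<lambda>x. antisym_map f x \<otimes> antisym_map g x)"
    by (rule tensor_map_mult[OF tuple_chainsD(1)[OF f] tuple_chainsD(1)[OF g]])
next
  fix n g assume g: "g \<in> or_chains G K n" "or_bd G n g = (\<lambda>x. \<one>)"
  then have "ord_bd G n (ascending_map g) = (\<lambda>x. \<one>)"
    by (simp add: ascending_map_bd)
  moreover have "ascending_map g \<in> ordered n"
    by (rule ascending_map_closed[OF or_chains_ordered[OF g(1)]])
  ultimately show "\<exists>f\<in>ordered n. ord_bd G n f = (\<lambda>x. \<one>) \<and> antisym_map f = g"
    using antisym_map_ascending_map[OF g(1)] by blast
next
  fix n f assume f: "f \<in> ordered n" "ord_bd G n f = (\<lambda>x. \<one>)"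
    and "antisym_map f \<in> or_bd G (Suc n) ` or_chains G K (Suc n)"
  then obtain g where g: "g \<in> or_chains G K (Suc n)" "antisym_map f = or_bd G (Suc n) g" by blast
  let ?h = "tensor_map G sort_homotopy f"
  have asc_g: "ascending_map g \<in> ordered (Suc n)"
    by (rule ascending_map_closed[OF or_chains_ordered[OF g(1)]])
  \<comment> \<open>Applying \<open>ascending_map\<close> to the bounding relation shows that the
    sorted cycle bounds, and the homotopy returns from it to \<open>f\<close>.\<close>
  have "tensor_map G sort_signed f = ord_bd G (Suc n) (ascending_map g)"
    by (simp add: ascending_map_bd[OF g(1)] g(2)[symmetric] sort_map_eq[OF tuple_chainsD(1)[OF f(1)]])
  then have "f = ord_bd G (Suc n) (\<lambda>x. ascending_map g x \<otimes> ?h x)"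
    using cycle_homologous_sort[OF f] ordered.d_mult[OF asc_g sort_homotopy_closed[OF f(1)]] by simp
  then show "f \<in> ord_bd G (Suc n) ` ordered (Suc n)"
    using ordered.C_mult[OF asc_g sort_homotopy_closed[OF f(1)]] by blast
qed (rule ordered.coeff_complex_axioms coeff_complex_or_chains tensor_map_one)+

end

section \<open>Graphs\<close>

text \<open>Simplices of \<open>X^U\<close> constrain only pairs of positions \<open>i < j\<close>,
  but edges are unordered, so both orders are covered. The diagonal accounts for repeated
  entries.\<close>

lemma ascending_edge_rel_iff_clique:
  assumes "xs \<noteq> []"
  shows "set xs \<subseteq> V \<and> sorted_wrt (\<lambda>x y. (x, y) \<in> edge_rel E \<union> Id_on V) xs \<longleftrightarrow> set xs \<in> clique_complex V E"
    (is "?l \<longleftrightarrow> ?r")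
proof
  assume l: ?l
  have "{x, y} \<in> E" if xy: "x \<in> set xs" "y \<in> set xs" "x \<noteq> y" for x y
  proof -
    have edge: "{xs ! i, xs ! j} \<in> E" if "i < j" "j < length xs" "xs ! i \<noteq> xs ! j" for i j
    proof -
      have "(xs ! i, xs ! j) \<in> edge_rel E \<union> Id_on V"
        using l that unfolding sorted_wrt_iff_nth_less by blast
      with that(3) show ?thesis by (auto simp: edge_rel_def)
    qed
    obtain i j where "i < length xs" "j < length xs" "x = xs ! i" "y = xs ! j"
      using xy by (auto simp: in_set_conv_nth)
    with edge[of i j] edge[of j i] xy(3) show ?thesis
      by (cases i j rule: linorder_cases) (auto simp: insert_commute)
  qed
  with l assms show ?r by (auto simp: clique_complex_def)
next
  assume r: ?r
  then have "(x, y) \<in> edge_rel E \<union> Id_on V" if "x \<in> set xs" "y \<in> set xs" for x y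
    using that by (cases "x = y") (auto simp: clique_complex_def edge_rel_def)
  then have "sorted_wrt (\<lambda>x y. (x, y) \<in> edge_rel E \<union> Id_on V) xs"
    unfolding sorted_wrt_iff_nth_less by auto
  with r show ?l by (auto simp: clique_complex_def)
qed

lemma XU_chains_edge_rel:
  "XU_chains G V (edge_rel E \<union> Id_on V) = tuple_chains G (\<lambda>xs. set xs \<in> clique_complex V E)"
proof -
  have "length xs = Suc n \<and> set xs \<subseteq> V \<and> sorted_wrt (\<lambda>x y. (x, y) \<in> edge_rel E \<union> Id_on V) xs \<longleftrightarrow>
      length xs = Suc n \<and> set xs \<in> clique_complex V E" for n xs
    using ascending_edge_rel_iff_clique[of xs V E] by (cases xs) auto
  then show ?thesis
    unfolding XU_chains_eq_tuple_chains[abs_def] tuple_chains_def by simp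
qed

theorem theorem5p2:
  fixes A :: "('a, 'm) monoid_scheme" and V :: "'v set" and E :: "'v set set"
  assumes "comm_group A"
    and "undirected_graph V E"
  shows "\<forall>n. graph_VR_homology A V E n \<cong> VR_homology A V (sigma_graph V E) n"
proof
  fix n
  interpret comm_group A by fact
  obtain lt :: "'v \<Rightarrow> 'v \<Rightarrow> bool" where lt: "strict_total_order lt"
    using ex_strict_total_order by blast
  interpret complex_comparison A lt "clique_complex V E"
    using lt assms(1)
    by (intro complex_comparison.intro complex_comparison_axioms.intro)
       (auto simp: clique_complex_def intro: finite_subset)
  let ?U0 = "edge_rel E \<union> Id_on V"
  have "XU_homology A V ?U0 n \<cong> graph_VR_homology A V E n"
    unfolding XU_homology_def XU_chains_edge_rel graph_VR_homology_def
    by (rule ordered_homology_iso_simplicial_homology)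
  moreover have "group (XU_homology A V ?U0 n)"
    unfolding XU_homology_def by (rule coeff_complex.group_homology_of[OF coeff_complex_XU_chains])
  ultimately have "graph_VR_homology A V E n \<cong> XU_homology A V ?U0 n"
    by (rule group.iso_sym[rotated])
  moreover have "XU_homology A V ?U0 n \<cong> VR_homology A V (sigma_graph V E) n"
  proof (rule VR_homology_least_entourage)
    \<comment> \<open>Edges are subsets of \<open>V\<close>, so \<open>?U0\<close> is a relation on
      \<open>V\<close> and belongs to the filter that it generates.\<close>
    show "?U0 \<in> sigma_graph V E"
      using assms(2) by (auto simp: sigma_graph_def edge_rel_def undirected_graph_def)
  qed (simp add: sigma_graph_def)
  ultimately show "graph_VR_homology A V E n \<cong> VR_homology A V (sigma_graph V E) n"
    by (rule iso_trans)
qed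

end
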